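(* For all integers $k \geq 7$ and $n \geq 2k-5$, $$\left(1 + \frac{1}{k+2}\right)n - 1 < \mathrm{sat}(n,C_k) < \left(1 + \frac{1}{k-4}\right)n + \binom{k-4}{2}.$$
   Context: All graphs are finite and simple. $C_k$ denotes the cycle of length $k$ (on $k$ vertices). A graph $G$ is $H$-saturated if it does not contain $H$ as a (not necessarily induced) subgraph, but for every edge $e$ of the complement $\overline{G}$ the graph $G+e$ contains a copy of $H$. $\mathrm{sat}(n,H)$ denotes the minimum number of edges of an $H$-saturated graph on $n$ vertices. *)

theory Defs
  imports Complex_Main
begin

record 'a ugraph =
  verts :: "'a set"
  edges :: "'a set set"

definition all_edges :: "'a set \<Rightarrow> 'a set set" where
  "all_edges V = {e. e \<subseteq> V \<and> card e = 2}"

definition simple_graph :: "'a ugraph \<Rightarrow> bool" where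
  "simple_graph G \<longleftrightarrow> finite (verts G) \<and> edges G \<subseteq> all_edges (verts G)"

definition complement_edges :: "'a ugraph \<Rightarrow> 'a set set" where
  "complement_edges G = all_edges (verts G) - edges G"

definition add_edge :: "'a ugraph \<Rightarrow> 'a set \<Rightarrow> 'a ugraph" where
  "add_edge G e = G\<lparr>edges := insert e (edges G)\<rparr>"

(* A not necessarily induced copy of H in G: non-edges of H are unconstrained. *)
definition contains_copy :: "'a ugraph \<Rightarrow> 'b ugraph \<Rightarrow> bool" where
  "contains_copy G H \<longleftrightarrow>
     (\<exists>f. inj_on f (verts H) \<and> f ` verts H \<subseteq> verts G \<and> (\<forall>e\<in>edges H. f ` e \<in> edges G))"

definition saturated :: "'b ugraph \<Rightarrow> 'a ugraph \<Rightarrow> bool" where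
  "saturated H G \<longleftrightarrow>
     \<not> contains_copy G H \<and> (\<forall>e\<in>complement_edges G. contains_copy (add_edge G e) H)"

(* Vertices are drawn from nat without loss of generality: saturation is invariant under
   graph isomorphism.  The minimum exists whenever H is a simple graph with at least one
   edge, see sat_attained. *)
definition sat :: "nat \<Rightarrow> 'b ugraph \<Rightarrow> nat" where
  "sat n H = (LEAST m. \<exists>G :: nat ugraph.
     simple_graph G \<and> card (verts G) = n \<and> saturated H G \<and> card (edges G) = m)"

(* This is the cycle of length k only for k \<ge> 3. *)
definition cycle_graph :: "nat \<Rightarrow> nat ugraph" where
  "cycle_graph k = \<lparr>verts = {..<k}, edges = (\<lambda>i. {i, Suc i mod k}) ` {..<k}\<rparr>"

lemma simple_graph_cycle_graph:
  assumes "k \<ge> 3"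
  shows "simple_graph (cycle_graph k)"
proof -
  have "{i, Suc i mod k} \<in> all_edges {..<k}" if "i < k" for i
  proof -
    have "Suc i mod k \<noteq> i"
      using assms that by (cases "Suc i = k") auto
    then show ?thesis
      using that by (auto simp: all_edges_def)
  qed
  then show ?thesis
    by (auto simp: simple_graph_def cycle_graph_def)
qed

lemma card_edges_cycle_graph:
  assumes "k \<ge> 3"
  shows "card (edges (cycle_graph k)) = k"
proof -
  have "inj_on (\<lambda>i. {i, Suc i mod k}) {..<k}"
  proof (rule inj_onI)
    fix i j
    assume i: "i \<in> {..<k}" and j: "j \<in> {..<k}" and eq: "{i, Suc i mod k} = {j, Suc j mod k}"
    show "i = j"
    proof (rule ccontr)
      assume "i \<noteq> j"
      with eq have "i = Suc j mod k" "j = Suc i mod k"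
        by (auto simp: doubleton_eq_iff)
      moreover have "Suc m mod k = (if Suc m = k then 0 else Suc m)" if "m < k" for m
        using that by simp
      ultimately show False
        using i j assms by (auto split: if_splits)
    qed
  qed
  then show ?thesis
    by (simp add: cycle_graph_def card_image)
qed

lemma saturated_exists:
  assumes "finite V" "edges H \<noteq> {}"
  shows "\<exists>G. simple_graph G \<and> verts G = V \<and> saturated H G"
proof -
  define S where "S = {E. E \<subseteq> all_edges V \<and> \<not> contains_copy \<lparr>verts = V, edges = E\<rparr> H}"
  have "finite (all_edges V)"
    using assms(1) by (auto simp: all_edges_def)
  then have "finite S"
    by (auto simp: S_def)
  moreover have "{} \<in> S"
    using assms(2) by (auto simp: S_def contains_copy_def)
  ultimately obtain E where E: "E \<in> S" and max: "\<And>F. F \<in> S \<Longrightarrow> E \<subseteq> F \<Longrightarrow> E = F"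
    using finite_has_maximal[of S] by blast
  have "contains_copy \<lparr>verts = V, edges = insert e E\<rparr> H" if "e \<in> all_edges V - E" for e
    using max[of "insert e E"] E that by (auto simp: S_def)
  then have "saturated H \<lparr>verts = V, edges = E\<rparr>"
    using E by (auto simp: saturated_def complement_edges_def add_edge_def S_def)
  moreover have "simple_graph \<lparr>verts = V, edges = E\<rparr>"
    using E assms(1) by (auto simp: simple_graph_def S_def)
  ultimately show ?thesis
    by fastforce
qed

lemma sat_attained:
  assumes "edges H \<noteq> {}"
  shows "\<exists>G :: nat ugraph.
    simple_graph G \<and> card (verts G) = n \<and> saturated H G \<and> card (edges G) = sat n H"
proof -
  have "\<exists>m. \<exists>G :: nat ugraph.
      simple_graph G \<and> card (verts G) = n \<and> saturated H G \<and> card (edges G) = m"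
    using saturated_exists[of "{..<n}" H] assms by fastforce
  then show ?thesis
    unfolding sat_def by (rule LeastI_ex)
qed

lemma sat_le:
  fixes G :: "nat ugraph"
  assumes "simple_graph G" "saturated H G"
  shows "sat (card (verts G)) H \<le> card (edges G)"
  unfolding sat_def using assms by (intro Least_le) blast

end

theory Submission
  imports Defs "HOL-Library.Countable"
begin

text \<open>
  A graph without a cycle of length \<open>k\<close> is saturated exactly if any two nonadjacent vertices are the
  ends of a path on \<open>k\<close> vertices. Both bounds are read off from this.

  \<^bold>\<open>Lower bound.\<close> The number that matters is the cyclomatic number \<open>\<beta> = e - n + 1\<close>: the claim is
  \<open>n < (k + 2) \<beta>\<close>. In a saturated graph a vertex has at most one pendant (degree one) neighbour, and
  deleting all pendant vertices does not change \<open>\<beta>\<close>. The remaining graph has minimum degree at least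
  two, and its nonadjacent vertices are still the ends of paths on \<open>k\<close> vertices. Two estimates are added.
  \<^item> The graph without pendant vertices has at most \<open>1 + (k - 1) \<beta>\<close> vertices
    (\<open>vertices_le_cyclomatic\<close>). It can be exhausted from a single vertex by steps each of which raises
    the cyclomatic number by some \<open>j\<close> and adds at most \<open>j (k - 1)\<close> vertices (\<open>gain_step\<close>). A step
    attaches an ear, namely a path or a cycle obtained from one of the paths on \<open>k\<close> vertices. The only ear
    that is too long by one vertex is a cycle of length \<open>k + 1\<close> hanging at a single vertex, and a
    second path on \<open>k\<close> vertices then supplies a second ear (\<open>gain_cycle_touching_once\<close>).
  \<^item> There are at most \<open>3 (\<beta> - 1)\<close> pendant vertices. If \<open>w\<close> has a pendant neighbour, then all other
    neighbours of \<open>w\<close> have degree at least three after the deletion, because a neighbour \<open>u\<close> of degree two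
    could replace the pendant vertex in a path on \<open>k\<close> vertices from there to the other neighbour of \<open>u\<close>,
    which gives a cycle of length \<open>k\<close>. Counting edges from both sides gives the estimate (\<open>card_sources_le\<close>).

  \<^bold>\<open>Upper bound.\<close> Take a dense graph on \<open>k - 1\<close> vertices in which two adjacent poles are joined
  by paths of every length from \<open>1\<close> to \<open>k - 2\<close> except \<open>3\<close>, and connect the two poles by arbitrarily
  many chains of length \<open>k - 3\<close>. A cycle of length \<open>k\<close> is too long for the dense part; it would need
  either two chains, which close a cycle of length \<open>2 k - 6\<close>, or one chain and a path of the
  missing length \<open>3\<close>. All the lengths that are present serve to join nonadjacent vertices. Each chain
  adds \<open>k - 4\<close> vertices and \<open>k - 3\<close> edges, which explains the factor \<open>1 + 1 / (k - 4)\<close>; fewer than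
  \<open>k - 4\<close> pendant vertices at the dense part adjust the number of vertices.
\<close>

section \<open>Saturation in terms of paths\<close>

abbreviation adj :: "'a ugraph \<Rightarrow> 'a \<Rightarrow> 'a \<Rightarrow> bool" where
  "adj G a b \<equiv> {a, b} \<in> edges G"

definition path :: "'a ugraph \<Rightarrow> 'a list \<Rightarrow> bool" where
  "path G xs \<longleftrightarrow> distinct xs \<and> set xs \<subseteq> verts G \<and> successively (adj G) xs"

text \<open>Here \<open>k\<close> counts the vertices of the path, so that a further edge between its ends closes a cycle
  of length \<open>k\<close>.\<close>
definition joined :: "'a ugraph \<Rightarrow> nat \<Rightarrow> 'a \<Rightarrow> 'a \<Rightarrow> bool" where
  "joined G k u v \<longleftrightarrow> (\<exists>xs. path G xs \<and> length xs = k \<and> hd xs = u \<and> last xs = v)"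

lemma path_rev: "path G (rev xs) \<longleftrightarrow> path G xs"
  by (simp add: path_def successively_rev insert_commute)

lemma joined_sym:
  assumes "joined G k u v"
  shows "joined G k v u"
proof -
  obtain xs where "path G xs" "length xs = k" "hd xs = u" "last xs = v"
    using assms by (auto simp: joined_def)
  then show ?thesis
    unfolding joined_def
    by (intro exI[of _ "rev xs"]) (simp add: path_rev hd_rev last_rev)
qed

lemma copy_of_joined:
  assumes "joined G k u v" "k \<ge> 2"
  shows "contains_copy (add_edge G {u, v}) (cycle_graph k)"
proof -
  obtain xs where xs: "path G xs" "length xs = k" "hd xs = u" "last xs = v"
    using assms(1) by (auto simp: joined_def)
  have "(!) xs ` {i, Suc i mod k} \<in> insert {u, v} (edges G)" if "i < k" for i
  proof (cases "Suc i = k")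
    case True
    then have "xs ! i = v" "xs ! 0 = u"
      using xs assms(2) hd_conv_nth[of xs] last_conv_nth[of xs] by fastforce+
    then show ?thesis
      using True by (simp add: insert_commute)
  next
    case False
    then show ?thesis
      using xs that by (simp add: path_def successively_conv_nth)
  qed
  moreover have "inj_on ((!) xs) {..<k}"
    using xs by (auto simp: path_def inj_on_nth)
  moreover have "(!) xs ` {..<k} \<subseteq> verts G"
    using xs by (auto simp: path_def)
  ultimately show ?thesis
    unfolding contains_copy_def
    by (intro exI[of _ "(!) xs"]) (auto simp: add_edge_def cycle_graph_def)
qed

text \<open>The new cycle must use the new edge; cutting it there leaves the path.\<close>
lemma joined_of_copy:
  assumes free: "\<not> contains_copy G (cycle_graph k)"
    and copy: "contains_copy (add_edge G {u, v}) (cycle_graph k)"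
    and "k \<ge> 3"
  shows "joined G k u v"
proof -
  define e where "e = {u, v}"
  obtain f where f: "inj_on f {..<k}" "f ` {..<k} \<subseteq> verts G"
    and fe: "\<And>i. i < k \<Longrightarrow> f ` {i, Suc i mod k} \<in> insert e (edges G)"
    using copy unfolding contains_copy_def e_def[symmetric] by (auto simp: add_edge_def cycle_graph_def)
  obtain i where i: "i < k" "f ` {i, Suc i mod k} = e"
  proof -
    have "\<exists>i<k. f ` {i, Suc i mod k} \<notin> edges G"
      using free f unfolding contains_copy_def by (auto simp: cycle_graph_def)
    then show ?thesis
      using fe that by blast
  qed
  have e_only: "f ` {j, Suc j mod k} \<in> edges G" if "j < k" "j \<noteq> i" for j
  proof -
    have "Suc m mod k = (if Suc m = k then 0 else Suc m)" if "m < k" for m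
      using that by simp
    then have "\<not> (j = Suc i mod k \<and> i = Suc j mod k)"
      using that i(1) assms(3) by (auto split: if_splits)
    then have "{j, Suc j mod k} \<noteq> {i, Suc i mod k}"
      using that by (auto simp: doubleton_eq_iff)
    moreover have "{j, Suc j mod k} \<subseteq> {..<k}" "{i, Suc i mod k} \<subseteq> {..<k}"
      using that i(1) by auto
    ultimately have "f ` {j, Suc j mod k} \<noteq> e"
      using f(1) i(2) inj_on_image_eq_iff by metis
    then show ?thesis
      using fe[OF that(1)] by blast
  qed
  define js where "js = [Suc i..<k] @ [0..<Suc i]"
  have js: "set js = {..<k}" "distinct js" "length js = k"
    using i(1) by (auto simp: js_def)
  have "adj G (f j) (f (Suc j))" if "Suc j < k" "j \<noteq> i" for j
    using e_only[of j] that by simp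
  moreover have "adj G (f (k - 1)) (f 0)" if "i \<noteq> k - 1"
    using e_only[of "k - 1"] that i(1) by simp
  ultimately have "successively (\<lambda>a b. adj G (f a) (f b)) [Suc i..<k]"
    "successively (\<lambda>a b. adj G (f a) (f b)) [0..<Suc i]"
    "Suc i < k \<Longrightarrow> adj G (f (k - 1)) (f 0)"
    using i(1) by (auto simp: successively_conv_nth simp del: upt_Suc)
  then have "successively (\<lambda>a b. adj G (f a) (f b)) js"
    using i(1) unfolding js_def successively_append_iff
    by (cases "Suc i < k") (simp_all del: upt_Suc)
  then have "path G (map f js)"
    using js f by (auto simp: path_def distinct_map successively_map)
  moreover have "hd js = Suc i mod k"
    using i(1) by (cases "Suc i = k") (simp_all add: js_def del: upt_Suc)
  then have "hd (map f js) = f (Suc i mod k)"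
    using i(1) by (subst hd_map) (auto simp: js_def)
  moreover have "last (map f js) = f i"
    by (simp add: js_def)
  ultimately have "joined G k (f (Suc i mod k)) (f i)"
    using js(3) unfolding joined_def by (intro exI[of _ "map f js"]) simp
  moreover have "f i = u \<and> f (Suc i mod k) = v \<or> f i = v \<and> f (Suc i mod k) = u"
    using i(2) unfolding e_def by (simp add: doubleton_eq_iff)
  ultimately show ?thesis
    using joined_sym[of G k v u] by auto
qed

lemma saturated_cycle_iff:
  assumes "k \<ge> 3"
  shows "saturated (cycle_graph k) G \<longleftrightarrow> \<not> contains_copy G (cycle_graph k) \<and>
    (\<forall>u\<in>verts G. \<forall>v\<in>verts G. u \<noteq> v \<longrightarrow> \<not> adj G u v \<longrightarrow> joined G k u v)"
proof -
  have "complement_edges G = (\<lambda>(u, v). {u, v}) ` {(u, v). u \<in> verts G \<and> v \<in> verts G \<and> u \<noteq> v \<and> \<not> adj G u v}"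
    by (auto simp: complement_edges_def all_edges_def card_2_iff)
  then have "(\<forall>e\<in>complement_edges G. P e) \<longleftrightarrow>
      (\<forall>u\<in>verts G. \<forall>v\<in>verts G. u \<noteq> v \<longrightarrow> \<not> adj G u v \<longrightarrow> P {u, v})" for P
    by auto
  moreover have "contains_copy (add_edge G {u, v}) (cycle_graph k) \<longleftrightarrow> joined G k u v"
    if "\<not> contains_copy G (cycle_graph k)" for u v
    using assms that joined_of_copy[of G k u v] copy_of_joined[of G k u v] by auto
  ultimately show ?thesis
    unfolding saturated_def by auto
qed

definition relabel :: "('a \<Rightarrow> 'b) \<Rightarrow> 'a ugraph \<Rightarrow> 'b ugraph" where
  "relabel f G = \<lparr>verts = f ` verts G, edges = (`) f ` edges G\<rparr>"

lemma contains_copy_relabel_iff: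
  assumes "inj f"
  shows "contains_copy (relabel f G) H \<longleftrightarrow> contains_copy G H"
proof
  assume "contains_copy G H"
  then obtain g where g: "inj_on g (verts H)" "g ` verts H \<subseteq> verts G" "\<forall>e\<in>edges H. g ` e \<in> edges G"
    by (auto simp: contains_copy_def)
  have "inj_on (f \<circ> g) (verts H)"
    using g(1) assms by (meson comp_inj_on inj_on_subset subset_UNIV)
  moreover have "(f \<circ> g) ` verts H \<subseteq> f ` verts G"
    using g(2) by auto
  moreover have "(f \<circ> g) ` e \<in> (`) f ` edges G" if "e \<in> edges H" for e
    using g(3) that by (metis image_comp imageI)
  ultimately show "contains_copy (relabel f G) H"
    unfolding contains_copy_def relabel_def ugraph.simps by blast
next
  assume "contains_copy (relabel f G) H"
  then obtain g where g: "inj_on g (verts H)" "g ` verts H \<subseteq> f ` verts G" "\<forall>e\<in>edges H. g ` e \<in> (`) f ` edges G"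
    by (auto simp: contains_copy_def relabel_def)
  have "inj_on (inv f) (g ` verts H)"
    using g(2) by (intro inj_on_inv_into) auto
  then have "inj_on (inv f \<circ> g) (verts H)"
    using g(1) by (rule comp_inj_on[rotated])
  moreover have "(inv f \<circ> g) ` verts H \<subseteq> verts G"
    using g(2) assms by (auto simp: image_subset_iff)
  moreover have "(inv f \<circ> g) ` e \<in> edges G" if e: "e \<in> edges H" for e
  proof -
    obtain d where d: "d \<in> edges G" "g ` e = f ` d"
      using g(3) e by auto
    have "(inv f \<circ> g) ` e = inv f ` f ` d"
      using d(2) by (metis image_comp)
    also have "\<dots> = d"
      using assms by (rule image_inv_f_f)
    finally show ?thesis
      using d(1) by simp
  qed
  ultimately show "contains_copy G H"
    unfolding contains_copy_def by blast
qed

text \<open>The number \<open>sat\<close> is defined by graphs on natural numbers. Saturation is invariant under relabelling, so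
  a construction may use any countable vertex type.\<close>
lemma sat_le_relabel:
  fixes G :: "'a::countable ugraph"
  assumes "simple_graph G" "saturated H G"
  shows "sat (card (verts G)) H \<le> card (edges G)"
proof -
  define f :: "'a \<Rightarrow> nat" where "f = to_nat"
  have f: "inj f"
    by (simp add: f_def)
  have "add_edge (relabel f G) (f ` e) = relabel f (add_edge G e)" for e
    by (simp add: add_edge_def relabel_def)
  moreover have "\<exists>e'\<in>complement_edges G. e = f ` e'" if "e \<in> complement_edges (relabel f G)" for e
  proof -
    have "e \<subseteq> f ` verts G" "card e = 2" "e \<notin> (`) f ` edges G"
      using that by (auto simp: complement_edges_def all_edges_def relabel_def)
    then obtain e' where "e' \<subseteq> verts G" "e = f ` e'"
      by (auto simp: subset_image_iff)
    then show ?thesis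
      using \<open>card e = 2\<close> \<open>e \<notin> (`) f ` edges G\<close> card_image[OF inj_on_subset[OF f subset_UNIV], of e']
      by (auto simp: complement_edges_def all_edges_def)
  qed
  ultimately have "saturated H (relabel f G)"
    using assms(2) contains_copy_relabel_iff[OF f] unfolding saturated_def by metis
  moreover have "f ` e \<in> all_edges (f ` verts G)" if "e \<in> all_edges (verts G)" for e
    using that card_image[OF inj_on_subset[OF f subset_UNIV], of e] by (auto simp: all_edges_def)
  then have "simple_graph (relabel f G)"
    using assms(1) by (auto simp: simple_graph_def relabel_def)
  ultimately have "sat (card (verts (relabel f G))) H \<le> card (edges (relabel f G))"
    by (rule sat_le[rotated])
  moreover have "card (verts (relabel f G)) = card (verts G)"
    using inj_on_subset[OF f subset_UNIV] by (simp add: relabel_def card_image)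
  moreover have "card (edges (relabel f G)) = card (edges G)"
    unfolding relabel_def ugraph.simps
    by (rule card_image) (auto simp: inj_on_def inj_image_eq_iff[OF f])
  ultimately show ?thesis
    by simp
qed

section \<open>Growing a vertex set and its cyclomatic number\<close>

definition inner_edges :: "'a ugraph \<Rightarrow> 'a set \<Rightarrow> nat" where
  "inner_edges G W = card {e \<in> edges G. e \<subseteq> W}"

lemma simple_graph_finite_edges:
  assumes "simple_graph G"
  shows "finite (edges G)"
  using assms finite_subset[of "edges G" "Pow (verts G)"]
  by (auto simp: simple_graph_def all_edges_def)

lemma simple_graph_adjD:
  assumes "simple_graph G" "adj G a b"
  shows "a \<in> verts G" "b \<in> verts G" "a \<noteq> b"
proof -
  have "{a, b} \<subseteq> verts G \<and> card {a, b} = 2"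
    using assms unfolding simple_graph_def all_edges_def by blast
  then show "a \<in> verts G" "b \<in> verts G" "a \<noteq> b"
    by auto
qed

lemma inner_edges_verts:
  assumes "simple_graph G"
  shows "inner_edges G (verts G) = card (edges G)"
proof -
  have "{e \<in> edges G. e \<subseteq> verts G} = edges G"
    using assms by (auto simp: simple_graph_def all_edges_def)
  then show ?thesis by (simp add: inner_edges_def)
qed

lemma inner_edges_grow:
  assumes "finite (edges G)" "F \<subseteq> edges G" "\<And>e. e \<in> F \<Longrightarrow> e \<subseteq> W' \<and> \<not> e \<subseteq> W" "W \<subseteq> W'"
  shows "inner_edges G W + card F \<le> inner_edges G W'"
proof -
  have "inner_edges G W + card F = card ({e \<in> edges G. e \<subseteq> W} \<union> F)"
    unfolding inner_edges_def
    using assms by (intro card_Un_disjoint[symmetric]) (auto intro: finite_subset)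
  also have "\<dots> \<le> inner_edges G W'"
    unfolding inner_edges_def using assms by (intro card_mono) auto
  finally show ?thesis .
qed

text \<open>Each vertex that the walk newly reaches brings at least the edge by which it is reached.\<close>
lemma inner_edges_walk:
  assumes "finite (edges G)" "successively (adj G) (x # xs)" "x \<in> W"
  shows "inner_edges G W + card (set xs - W) \<le> inner_edges G (W \<union> set xs)"
  using assms(2,3)
proof (induction xs arbitrary: x W)
  case Nil
  then show ?case by simp
next
  case (Cons y xs)
  have IH: "inner_edges G (insert y W) + card (set xs - insert y W) \<le> inner_edges G (insert y W \<union> set xs)"
    using Cons by (intro Cons.IH) auto
  have eq: "insert y W \<union> set xs = W \<union> set (y # xs)"
    by auto
  show ?case
  proof (cases "y \<in> W")
    case True
    then show ?thesis
      using IH by (simp add: insert_absorb)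
  next
    case False
    then have "set (y # xs) - W = insert y (set xs - insert y W)"
      by auto
    then have "card (set (y # xs) - W) = Suc (card (set xs - insert y W))"
      by simp
    moreover have "inner_edges G W + card {{x, y}} \<le> inner_edges G (insert y W)"
      using Cons.prems False by (intro inner_edges_grow assms(1)) auto
    ultimately show ?thesis
      using IH by (simp add: eq[symmetric])
  qed
qed

text \<open>Compared with a walk, a path or cycle that returns to \<open>W\<close> gains one more edge: the last new vertex \<open>z\<close>
  is also joined to its successor, which lies in \<open>W\<close>.\<close>
lemma inner_edges_ear:
  assumes fin: "finite (edges G)" and xs: "distinct xs" "successively (adj G) xs" "hd xs \<in> W"
    and out: "\<not> set xs \<subseteq> W"
    and close: "last xs \<in> W \<or> length xs \<ge> 3 \<and> adj G (last xs) (hd xs)"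
  shows "inner_edges G W + card (set xs - W) + 1 \<le> inner_edges G (W \<union> set xs)"
proof -
  obtain ys z zs where split: "xs = ys @ z # zs" and z: "z \<notin> W" and zs: "\<forall>y\<in>set zs. y \<in> W"
    using out split_list_last_prop[of xs "\<lambda>z. z \<notin> W"] by auto
  \<comment> \<open>The successor of \<open>z\<close>, which is the first vertex again if \<open>z\<close> is the last vertex of a cycle.\<close>
  define b where "b = hd (zs @ [hd xs])"
  have ys: "ys \<noteq> []"
    using xs(3) z split by auto
  then obtain u ys' where ys': "ys = u # ys'"
    by (cases ys) auto
  have u: "u \<in> W"
    using xs(3) split ys' by simp
  have b: "b \<in> W" "adj G z b" "b \<noteq> last ys"
  proof -
    consider "zs = []" | c cs where "zs = c # cs"
      by (cases zs) auto
    then have "b \<in> W \<and> adj G z b \<and> b \<noteq> last ys"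
    proof cases
      case 1
      then have "last xs = z"
        using split by simp
      then have "length xs \<ge> 3" "adj G z (hd xs)"
        using close z by auto
      then show ?thesis
        using 1 xs split ys' by (auto simp: b_def)
    next
      case 2
      then show ?thesis
        using xs split zs ys by (auto simp: b_def successively_append_iff)
    qed
    then show "b \<in> W" "adj G z b" "b \<noteq> last ys" by auto
  qed
  have succ: "successively (adj G) ys" "adj G (last ys) z"
    using xs split ys by (auto simp: successively_append_iff)
  define W1 where "W1 = W \<union> set ys'"
  have one: "inner_edges G W + card (set ys' - W) \<le> inner_edges G W1"
    using succ u unfolding W1_def ys' by (intro inner_edges_walk[OF fin, of u]) auto
  have z1: "z \<notin> W1"
    using z xs(1) split ys' by (auto simp: W1_def)
  have l1: "last ys \<in> W1"
    using u ys' last_in_set[OF ys] by (auto simp: W1_def)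
  have "inner_edges G W1 + card {{last ys, z}, {z, b}} \<le> inner_edges G (insert z W1)"
    using succ b l1 z1 by (intro inner_edges_grow fin) (auto simp: W1_def)
  moreover have "{last ys, z} \<noteq> {z, b}"
    using b(3) l1 z1 by (auto simp: doubleton_eq_iff)
  then have "card {{last ys, z}, {z, b}} = 2"
    by simp
  moreover have "W \<union> set xs = insert z W1"
    using split ys' u zs by (auto simp: W1_def)
  moreover have "set xs - W = insert z (set ys' - W)"
    using split ys' u zs z by auto
  then have "card (set xs - W) = Suc (card (set ys' - W))"
    using z1 by (simp add: W1_def)
  ultimately show ?thesis
    using one by simp
qed


text \<open>Passing from \<open>W\<close> to \<open>W'\<close> raises the cyclomatic number of the induced subgraph by at least \<open>j\<close>, at a
  price of at most \<open>k - 1\<close> new vertices per unit. The inequality between edges and vertices is written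
  with sums to avoid truncated subtraction.\<close>
definition gain :: "'a ugraph \<Rightarrow> nat \<Rightarrow> 'a set \<Rightarrow> 'a set \<Rightarrow> nat \<Rightarrow> bool" where
  "gain G k W W' j \<longleftrightarrow> W \<subset> W' \<and> W' \<subseteq> verts G \<and> card W' \<le> card W + j * (k - 1) \<and>
     inner_edges G W + card W' + j \<le> inner_edges G W' + card W"

lemma card_Un_outside:
  assumes "finite A" "finite B"
  shows "card (A \<union> B) = card A + card (B - A)"
  using card_Un_disjoint[of A "B - A"] assms by (simp add: Diff_disjoint)

lemma gain_ear:
  assumes G: "simple_graph G" and W: "W \<subseteq> verts G"
    and xs: "path G xs" "hd xs \<in> W" "\<not> set xs \<subseteq> W"
    and close: "last xs \<in> W \<or> length xs \<ge> 3 \<and> adj G (last xs) (hd xs)"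
    and small: "card (set xs - W) \<le> k - 1"
  shows "gain G k W (W \<union> set xs) 1"
proof -
  have fin: "finite W"
    using G W finite_subset by (auto simp: simple_graph_def)
  have "inner_edges G W + card (set xs - W) + 1 \<le> inner_edges G (W \<union> set xs)"
    using xs close by (intro inner_edges_ear simple_graph_finite_edges G) (auto simp: path_def)
  moreover have "card (W \<union> set xs) = card W + card (set xs - W)"
    using fin by (simp add: card_Un_outside)
  moreover have "W \<subset> W \<union> set xs" "W \<union> set xs \<subseteq> verts G"
    using xs W by (auto simp: path_def)
  ultimately show ?thesis
    using small unfolding gain_def by simp
qed

text \<open>A cycle of length \<open>k + 1\<close> that meets \<open>W\<close> in one vertex \<open>c\<^sub>0\<close> adds \<open>k\<close> vertices, one too many for a gain
  of one. A gain of two can always be reached instead. Either the cycle comes with an additional edge, or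
  \<open>c\<^sub>3\<close> and \<open>c\<^sub>0\<close> are nonadjacent. In the latter case a path on \<open>k\<close> vertices joins them and leaves \<open>W\<close>
  and the cycle, because along the cycle it would have length \<open>3\<close> or \<open>k - 2\<close> instead of \<open>k - 1\<close>. So it
  contains a second ear.\<close>
lemma gain_cycle_touching_once:
  assumes G: "simple_graph G" and k: "k \<ge> 7"
    and semi: "\<And>u v. u \<in> verts G \<Longrightarrow> v \<in> verts G \<Longrightarrow> u \<noteq> v \<Longrightarrow> \<not> adj G u v \<Longrightarrow> joined G k u v"
    and W: "W \<subseteq> verts G"
    and c: "path G c" "length c = Suc k" "adj G (last c) (hd c)" "set c \<inter> W = {hd c}"
  shows "\<exists>W'. gain G k W W' 2"
proof -
  have finE: "finite (edges G)" and finV: "finite (verts G)"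
    using G simple_graph_finite_edges by (auto simp: simple_graph_def)
  have finW: "finite W"
    using W finV by (rule finite_subset)
  have dc: "distinct c" and cV: "set c \<subseteq> verts G"
    using c(1) by (auto simp: path_def)
  have hd_c: "hd c = c ! 0" and last_c: "last c = c ! k"
    using c(2) hd_conv_nth[of c] last_conv_nth[of c] by force+
  define W1 where "W1 = W \<union> set c"
  have W1V: "W1 \<subseteq> verts G"
    using W cV by (auto simp: W1_def)
  have c_in: "c ! i \<in> W1" if "i \<le> k" for i
    using that c(2) by (auto simp: W1_def)
  have c_out: "c ! i \<notin> W" if "0 < i" "i \<le> k" for i
  proof
    assume "c ! i \<in> W"
    then have "c ! i \<in> set c \<inter> W"
      using c(2) that by simp
    then have "c ! i = c ! 0"
      unfolding c(4) hd_c by simp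
    then show False
      using that dc c(2) by (simp add: nth_eq_iff_index_eq)
  qed
  have "set c - W = set c - {hd c}"
    using c(4) by auto
  moreover have "hd c \<in> set c"
    using c(2) by (intro hd_in_set) auto
  ultimately have "card (set c - W) = k"
    using c(2) dc by (simp add: distinct_card)
  then have cardW1: "card W1 = card W + k"
    using finW by (simp add: W1_def card_Un_outside)
  define CE where "CE = (`) ((!) c) ` edges (cycle_graph (Suc k))"
  have CE_iff: "e \<in> CE \<longleftrightarrow> (\<exists>i\<le>k. e = {c ! i, c ! (Suc i mod Suc k)})" for e
    unfolding CE_def cycle_graph_def ugraph.simps image_image image_iff
    by (simp add: Bex_def less_Suc_eq_le del: mod_Suc_le_divisor)
  have "inj_on ((`) ((!) c)) (edges (cycle_graph (Suc k)))"
  proof (rule inj_onI)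
    fix a b
    assume ab: "a \<in> edges (cycle_graph (Suc k))" "b \<in> edges (cycle_graph (Suc k))" "(!) c ` a = (!) c ` b"
    have "inj_on ((!) c) {..<Suc k}"
      using dc c(2) by (auto simp: inj_on_nth)
    moreover have "a \<subseteq> {..<Suc k}" "b \<subseteq> {..<Suc k}"
      using ab by (auto simp: cycle_graph_def)
    ultimately show "a = b"
      using ab(3) inj_on_image_eq_iff by metis
  qed
  then have cardCE: "card CE = Suc k"
    unfolding CE_def using k by (subst card_image) (simp_all add: card_edges_cycle_graph)
  have CE_sub: "e \<in> edges G \<and> e \<subseteq> W1 \<and> \<not> e \<subseteq> W" if e: "e \<in> CE" for e
  proof -
    obtain i where i: "i \<le> k" "e = {c ! i, c ! (Suc i mod Suc k)}"
      using e unfolding CE_iff by blast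
    show ?thesis
    proof (cases "i = k")
      case True
      then show ?thesis
        using i c(3) hd_c last_c c_in[of k] c_in[of 0] c_out[of k] k by auto
    next
      case False
      then have "adj G (c ! i) (c ! Suc i)"
        using c(1,2) i(1) by (simp add: path_def successively_conv_nth)
      then show ?thesis
        using False i c_in[of i] c_in[of "Suc i"] c_out[of "Suc i"] by auto
    qed
  qed
  show ?thesis
  proof (cases "\<exists>f. f \<in> edges G \<and> f \<subseteq> W1 \<and> \<not> f \<subseteq> W \<and> f \<notin> CE")
    case True
    \<comment> \<open>The cycle and \<open>f\<close> together gain two, which pays for up to \<open>2 (k - 1)\<close> new vertices.\<close>
    then obtain f where f: "f \<in> edges G" "f \<subseteq> W1" "\<not> f \<subseteq> W" "f \<notin> CE"
      by auto
    have "finite CE"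
      using cardCE by (metis card.infinite nat.distinct(1))
    then have "card (insert f CE) = k + 2"
      using f cardCE by simp
    moreover have "inner_edges G W + card (insert f CE) \<le> inner_edges G W1"
      using f CE_sub by (intro inner_edges_grow finE) (auto simp: W1_def)
    moreover have "W \<subset> W1"
      using c_in[of 1] c_out[of 1] k by (auto simp: W1_def)
    ultimately have "gain G k W W1 2"
      using cardW1 W1V k unfolding gain_def by auto
    then show ?thesis ..
  next
    case False
    then have only_CE: "f \<in> CE" if "f \<in> edges G" "f \<subseteq> W1" "\<not> f \<subseteq> W" for f
      using that by blast
    \<comment> \<open>Without an additional edge, a vertex of the cycle other than \<open>c\<^sub>0\<close> has only its two neighbours on the
      cycle as neighbours in \<open>W1\<close>.\<close>
    have nbr: "x = c ! (i - 1) \<or> x = c ! (Suc i mod Suc k)"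
      if "0 < i" "i \<le> k" "x \<in> W1" "adj G (c ! i) x" for i x
    proof -
      have "{c ! i, x} \<in> CE"
        using that c_in[of i] c_out[of i] by (intro only_CE) auto
      then obtain j where j: "j \<le> k" "{c ! i, x} = {c ! j, c ! (Suc j mod Suc k)}"
        unfolding CE_iff by blast
      then consider "c ! i = c ! j" "x = c ! (Suc j mod Suc k)" | "c ! i = c ! (Suc j mod Suc k)" "x = c ! j"
        by (auto simp: doubleton_eq_iff)
      then show ?thesis
      proof cases
        case 1
        then have "i = j"
          using dc c(2) that j nth_eq_iff_index_eq[of c i j] by auto
        then show ?thesis using 1 by simp
      next
        case 2
        then have "i = Suc j mod Suc k"
          using dc c(2) that j nth_eq_iff_index_eq[of c i "Suc j mod Suc k"] by (auto simp: less_Suc_eq_le)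
        then have "i = Suc j"
          using that j by (cases "j = k") auto
        then show ?thesis using 2 by simp
      qed
    qed
    have c_eq: "c ! i = c ! j \<longleftrightarrow> i = j" if "i \<le> k" "j \<le> k" for i j
      using that dc c(2) nth_eq_iff_index_eq[of c i j] by auto
    have "c ! 3 \<noteq> c ! 0"
      using k c_eq[of 3 0] by simp
    moreover have "\<not> adj G (c ! 3) (c ! 0)"
      using nbr[of 3 "c ! 0"] c_in[of 0] k c_eq[of 0 2] c_eq[of 0 4] by auto
    ultimately have "joined G k (c ! 3) (c ! 0)"
      using semi k c_in[of 3] c_in[of 0] W1V by auto
    then obtain r where r: "path G r" "length r = k" "hd r = c ! 3" "last r = c ! 0"
      by (auto simp: joined_def)
    have r_eq: "r ! i = r ! j \<longleftrightarrow> i = j" if "i < k" "j < k" for i j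
      using that r(1,2) nth_eq_iff_index_eq[of r i j] by (auto simp: path_def)
    have r0: "r ! 0 = c ! 3" and rk: "r ! (k - 1) = c ! 0"
      using r(2,3,4) k hd_conv_nth[of r] last_conv_nth[of r] by force+
    have r_adj: "adj G (r ! i) (r ! Suc i)" if "Suc i < k" for i
      using r(1,2) that by (simp add: path_def successively_conv_nth)
    \<comment> \<open>Inside \<open>W1\<close> the path would have to run along the cycle, and it would meet \<open>c\<^sub>0\<close> too early in either
      direction.\<close>
    have "\<not> set r \<subseteq> W1"
    proof
      assume sub: "set r \<subseteq> W1"
      then have r_in: "r ! i \<in> W1" if "i < k" for i
        using that r(2) by auto
      have "r ! 1 = c ! 2 \<or> r ! 1 = c ! 4"
        using nbr[of 3 "r ! 1"] r_adj[of 0] r0 r_in[of 1] k by auto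
      then show False
      proof
        assume r1: "r ! 1 = c ! 2"
        have "r ! 2 = c ! 1 \<or> r ! 2 = c ! 3"
          using nbr[of 2 "r ! 2"] r_adj[of 1] r1 r_in[of 2] k by (auto simp: numeral_2_eq_2 numeral_3_eq_3)
        then have r2: "r ! 2 = c ! 1"
          using r_eq[of 2 0] r0 k by auto
        have "r ! 3 = c ! 0 \<or> r ! 3 = c ! 2"
          using nbr[of 1 "r ! 3"] r_adj[of 2] r2 r_in[of 3] k by (auto simp: numeral_2_eq_2 numeral_3_eq_3)
        then have "r ! 3 = r ! (k - 1)"
          using r_eq[of 3 1] r1 rk k by auto
        then show False
          using r_eq[of 3 "k - 1"] k by auto
      next
        assume r1: "r ! 1 = c ! 4"
        have run: "Suc j \<le> k - 3 \<Longrightarrow> r ! j = c ! (3 + j) \<and> r ! Suc j = c ! (4 + j)" for j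
        proof (induction j)
          case 0
          then show ?case using r0 r1 by simp
        next
          case (Suc j)
          then have IH: "r ! j = c ! (3 + j)" "r ! Suc j = c ! (4 + j)"
            by auto
          have "r ! Suc (Suc j) = c ! (3 + j) \<or> r ! Suc (Suc j) = c ! (5 + j)"
            using nbr[of "4 + j" "r ! Suc (Suc j)"] r_adj[of "Suc j"] IH r_in[of "Suc (Suc j)"] Suc.prems
            by (auto simp: eval_nat_numeral)
          then show ?case
            using IH r_eq[of "Suc (Suc j)" j] Suc.prems by (auto simp: eval_nat_numeral)
        qed
        have e: "Suc (k - 4) = k - 3" "3 + (k - 4) = k - 1" "4 + (k - 4) = k" "Suc (k - 3) = k - 2" "Suc (k - 2) = k - 1"
          using k by auto
        have rr: "r ! (k - 4) = c ! (k - 1)" "r ! (k - 3) = c ! k"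
          using run[of "k - 4"] unfolding e by auto
        have "r ! (k - 2) = c ! (k - 1) \<or> r ! (k - 2) = c ! 0"
          using nbr[of k "r ! (k - 2)"] r_adj[of "k - 3"] rr r_in[of "k - 2"] k unfolding e by auto
        then have "r ! (k - 2) = r ! (k - 4) \<or> r ! (k - 2) = r ! (k - 1)"
          using rr rk by auto
        then show False
          using r_eq[of "k - 2" "k - 4"] r_eq[of "k - 2" "k - 1"] k by auto
      qed
    qed
    then have "inner_edges G W1 + card (set r - W1) + 1 \<le> inner_edges G (W1 \<union> set r)"
      using r c_in[of 3] c_in[of 0] k by (intro inner_edges_ear finE) (auto simp: path_def)
    moreover have "inner_edges G W + card CE \<le> inner_edges G W1"
      using CE_sub by (intro inner_edges_grow finE) (auto simp: W1_def)
    moreover have "card (W1 \<union> set r) = card W1 + card (set r - W1)"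
      using finite_subset[OF W1V finV] by (simp add: card_Un_outside)
    moreover have "card (set r - W1) \<le> card (set r - {c ! 3, c ! 0})"
      using c_in[of 3] c_in[of 0] k by (intro card_mono) auto
    moreover have "card (set r - {c ! 3, c ! 0}) = k - 2"
    proof -
      have "{c ! 3, c ! 0} \<subseteq> set r"
        using r0 rk r(2) k nth_mem[of 0 r] nth_mem[of "k - 1" r] by auto
      then show ?thesis
        using r(1,2) c_eq[of 3 0] k by (simp add: card_Diff_subset distinct_card path_def)
    qed
    moreover have "W \<subset> W1 \<union> set r"
      using c_in[of 1] c_out[of 1] k by (auto simp: W1_def)
    moreover have "W1 \<union> set r \<subseteq> verts G"
      using W1V r(1) by (auto simp: path_def)
    ultimately have "gain G k W (W1 \<union> set r) 2"
      using cardCE cardW1 k unfolding gain_def by auto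
    then show ?thesis ..
  qed
qed

lemma successively_crossing:
  assumes "successively P xs" "xs \<noteq> []" "hd xs \<in> W" "last xs \<notin> W"
  obtains u v where "u \<in> W" "v \<notin> W" "u \<in> set xs" "v \<in> set xs" "P u v"
proof -
  obtain ys u zs where xs: "xs = ys @ u # zs" "u \<in> W" "\<forall>z\<in>set zs. z \<notin> W"
    using assms(2,3) split_list_last_prop[of xs "\<lambda>x. x \<in> W"] hd_in_set by blast
  then obtain v vs where "zs = v # vs"
    using assms(4) by (cases zs) auto
  then show thesis
    using xs assms(1) by (intro that[of u v]) (auto simp: successively_append_iff)
qed

text \<open>Let \<open>uv\<close> be an edge that leaves \<open>W\<close> at \<open>u\<close>, and let \<open>w\<close> be a second neighbour of \<open>v\<close>. If \<open>w\<close> is in \<open>W\<close>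
  or adjacent to \<open>u\<close>, there is an ear with at most two new vertices. Otherwise a path \<open>p\<close> on \<open>k\<close>
  vertices joins \<open>u\<close> and \<open>w\<close>. If \<open>p\<close> avoids \<open>v\<close>, then \<open>v\<close> closes it to a cycle of length \<open>k + 1\<close>,
  which is short enough if it meets \<open>W\<close> in a second vertex. If \<open>p\<close>
  begins with the edge \<open>uv\<close>, the rest of \<open>p\<close> and the edge \<open>wv\<close> form a cycle of length \<open>k - 1\<close> through
  \<open>v\<close>. If \<open>p\<close> reaches \<open>v\<close> later, its initial part is closed by the edge \<open>vu\<close>.\<close>
lemma gain_step:
  assumes G: "simple_graph G" and k: "k \<ge> 7"
    and min_deg: "\<And>u v. v \<in> verts G \<Longrightarrow> \<exists>w. w \<noteq> u \<and> adj G v w"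
    and semi: "\<And>u v. u \<in> verts G \<Longrightarrow> v \<in> verts G \<Longrightarrow> u \<noteq> v \<Longrightarrow> \<not> adj G u v \<Longrightarrow> joined G k u v"
    and W: "W \<subseteq> verts G" "W \<noteq> {}" "W \<noteq> verts G"
  shows "\<exists>W' j. gain G k W W' j"
proof -
  obtain u v where uv: "u \<in> W" "v \<in> verts G" "v \<notin> W" "adj G u v"
  proof -
    obtain a b where ab: "a \<in> W" "b \<in> verts G" "b \<notin> W"
      using W by auto
    show thesis
    proof (cases "adj G a b")
      case True
      then show thesis using ab that by blast
    next
      case False
      then have "joined G k a b"
        using ab W by (intro semi) auto
      then obtain xs where "path G xs" "length xs = k" "hd xs = a" "last xs = b"
        by (auto simp: joined_def)
      moreover from this have "xs \<noteq> []" "hd xs \<in> W" "last xs \<notin> W" "successively (adj G) xs"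
        using ab k by (auto simp: path_def)
      then obtain u v where "u \<in> W" "v \<notin> W" "u \<in> set xs" "v \<in> set xs" "adj G u v"
        using successively_crossing[of "adj G" xs W] by metis
      ultimately show thesis
        using that by (auto simp: path_def)
    qed
  qed
  obtain w where w: "w \<noteq> u" "adj G v w"
    using min_deg uv(2) by blast
  have V: "u \<in> verts G" "w \<in> verts G" "v \<noteq> w" "u \<noteq> v"
    using uv w simple_graph_adjD[OF G] by auto
  show ?thesis
  proof (cases "w \<in> W \<or> adj G u w")
    case True
    have "gain G k W (W \<union> set [u, v, w]) 1"
    proof (rule gain_ear[OF G W(1)])
      show "path G [u, v, w]"
        using uv w V by (auto simp: path_def)
      show "last [u, v, w] \<in> W \<or> length [u, v, w] \<ge> 3 \<and> adj G (last [u, v, w]) (hd [u, v, w])"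
        using True by (auto simp: insert_commute)
      have "card (set [u, v, w] - W) \<le> card {v, w}"
        using uv by (intro card_mono) auto
      then show "card (set [u, v, w] - W) \<le> k - 1"
        using k by (simp add: card_insert_if split: if_splits)
    qed (use uv in auto)
    then show ?thesis by blast
  next
    case False
    then have "joined G k u w"
      using V w by (intro semi) auto
    then obtain p where p: "path G p" "length p = k" "hd p = u" "last p = w"
      by (auto simp: joined_def)
    have p_ne: "p \<noteq> []"
      using p k by auto
    show ?thesis
    proof (cases "v \<in> set p")
      case False
      have c: "path G (p @ [v])" "length (p @ [v]) = Suc k" "hd (p @ [v]) = u" "adj G (last (p @ [v])) (hd (p @ [v]))"
        using p False uv w p_ne by (auto simp: path_def successively_append_iff insert_commute)
      have u_in: "u \<in> set (p @ [v])"
        using c(3) p_ne hd_in_set[of p] by auto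
      show ?thesis
      proof (cases "set (p @ [v]) \<inter> W = {u}")
        case True
        then show ?thesis
          using gain_cycle_touching_once[OF G k semi W(1) c(1,2,4)] c(3) by auto
      next
        case False
        then obtain x where x: "x \<in> set (p @ [v])" "x \<in> W" "x \<noteq> u"
          using u_in uv by blast
        have "card (set (p @ [v]) - W) \<le> card (set (p @ [v]) - {u, x})"
          using x uv by (intro card_mono) auto
        also have "\<dots> = k - 1"
          using c(1,2) x u_in by (subst card_Diff_subset) (auto simp: path_def distinct_card[of "p @ [v]", simplified])
        finally have "gain G k W (W \<union> set (p @ [v])) 1"
          using uv c k p(2) by (intro gain_ear[OF G W(1)]) auto
        then show ?thesis by blast
      qed
    next
      case True
      then obtain as bs where split: "p = as @ v # bs"
        by (auto dest: split_list)
      have "as \<noteq> []"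
        using p split V by (cases as) auto
      have "bs \<noteq> []"
        using p split V by (cases bs) auto
      show ?thesis
      proof (cases "length as = 1")
        case True
        define c where "c = v # bs"
        have len: "length c = k - 1"
          using p split True by (simp add: c_def)
        have c: "path G c" "hd c = v" "last c = w" "w \<in> set c"
          using p split \<open>bs \<noteq> []\<close> last_in_set[of bs]
          by (auto simp: c_def path_def successively_append_iff)
        define W1 where "W1 = insert v W"
        have fin: "finite W" "finite (edges G)"
          using G W(1) finite_subset simple_graph_finite_edges by (auto simp: simple_graph_def)
        have "inner_edges G W + card {{u, v}} \<le> inner_edges G W1"
          using uv by (intro inner_edges_grow fin) (auto simp: W1_def)
        moreover have "inner_edges G W1 + card (set c - W1) + 1 \<le> inner_edges G (W1 \<union> set c)"
          using c len k w V \<open>\<not> (w \<in> W \<or> adj G u w)\<close> fin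
          by (intro inner_edges_ear) (auto simp: path_def W1_def insert_commute)
        moreover have "W1 \<union> set c = W \<union> set c"
          by (auto simp: W1_def c_def)
        moreover have "set c - W = insert v (set c - W1)"
          using uv by (auto simp: W1_def c_def)
        then have "card (set c - W) = card (insert v (set c - W1))"
          by (rule arg_cong)
        then have "card (set c - W) = Suc (card (set c - W1))"
          by (subst (asm) card_insert_disjoint) (auto simp: W1_def)
        moreover have "card (W \<union> set c) = card W + card (set c - W)"
          using fin by (simp add: card_Un_outside)
        moreover have "card (set c - W) \<le> k - 1"
          using card_mono[of "set c" "set c - W"] card_length[of c] len by simp
        moreover have "W \<subset> W \<union> set c" "W \<union> set c \<subseteq> verts G"
          using c W(1) \<open>\<not> (w \<in> W \<or> adj G u w)\<close> by (auto simp: path_def)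
        ultimately have "gain G k W (W \<union> set c) 1"
          unfolding gain_def by auto
        then show ?thesis by blast
      next
        case False
        have "gain G k W (W \<union> set (as @ [v])) 1"
        proof (rule gain_ear[OF G W(1)])
          show "path G (as @ [v])"
            using p(1) split by (auto simp: path_def successively_append_iff)
          show "hd (as @ [v]) \<in> W"
            using \<open>as \<noteq> []\<close> p split uv by auto
          show "\<not> set (as @ [v]) \<subseteq> W"
            using uv by auto
          have "length as \<ge> 2"
            using False \<open>as \<noteq> []\<close> by (cases as; cases "tl as") auto
          then show "last (as @ [v]) \<in> W \<or> length (as @ [v]) \<ge> 3 \<and> adj G (last (as @ [v])) (hd (as @ [v]))"
            using \<open>as \<noteq> []\<close> p split uv by (auto simp: insert_commute)
          have "length (as @ [v]) < k"
            using p split \<open>bs \<noteq> []\<close> by (cases bs) auto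
          then show "card (set (as @ [v]) - W) \<le> k - 1"
            using card_mono[of "set (as @ [v])" "set (as @ [v]) - W"] card_length[of "as @ [v]"] by simp
        qed
        then show ?thesis by blast
      qed
    qed
  qed
qed


text \<open>Repeated steps from a single vertex, whose cyclomatic number is zero; \<open>j\<close> is the total gain.\<close>
lemma vertices_le_cyclomatic:
  assumes G: "simple_graph G" and k: "k \<ge> 7"
    and min_deg: "\<And>u v. v \<in> verts G \<Longrightarrow> \<exists>w. w \<noteq> u \<and> adj G v w"
    and semi: "\<And>u v. u \<in> verts G \<Longrightarrow> v \<in> verts G \<Longrightarrow> u \<noteq> v \<Longrightarrow> \<not> adj G u v \<Longrightarrow> joined G k u v"
    and ne: "verts G \<noteq> {}"
  obtains j where "card (verts G) \<le> 1 + j * (k - 1)" "card (verts G) + j \<le> card (edges G) + 1"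
proof -
  have fin: "finite (verts G)"
    using G by (simp add: simple_graph_def)
  have reach: "\<exists>j. card (verts G) \<le> card W + j * (k - 1) \<and>
      inner_edges G W + card (verts G) + j \<le> card (edges G) + card W"
    if "W \<subseteq> verts G" "W \<noteq> {}" for W
    using that
  proof (induction "card (verts G - W)" arbitrary: W rule: less_induct)
    case less
    show ?case
    proof (cases "W = verts G")
      case True
      then show ?thesis
        by (intro exI[of _ 0]) (simp add: inner_edges_verts[OF G])
    next
      case False
      then obtain W' j where W': "gain G k W W' j"
        using gain_step[OF G k min_deg semi] less.prems by blast
      have "card (verts G - W') < card (verts G - W)"
        using W' less.prems fin by (intro psubset_card_mono) (auto simp: gain_def)
      then obtain j' where j': "card (verts G) \<le> card W' + j' * (k - 1)"
        "inner_edges G W' + card (verts G) + j' \<le> card (edges G) + card W'"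
        using less.hyps[of W'] W' by (auto simp: gain_def)
      show ?thesis
        using j' W' unfolding gain_def by (intro exI[of _ "j + j'"]) (simp add: add_mult_distrib)
    qed
  qed
  obtain u where "u \<in> verts G"
    using ne by auto
  then show thesis
    using reach[of "{u}"] that by auto
qed


section \<open>Pendant vertices and the lower bound\<close>

definition degree :: "'a ugraph \<Rightarrow> 'a \<Rightarrow> nat" where
  "degree G v = card {e \<in> edges G. v \<in> e}"

lemma sum_degree:
  assumes "finite (edges G)" "finite A"
  shows "(\<Sum>v\<in>A. degree G v) = (\<Sum>e\<in>edges G. card (e \<inter> A))"
proof -
  have "(\<Sum>v\<in>A. degree G v) = (\<Sum>v\<in>A. \<Sum>e\<in>edges G. if v \<in> e then 1 else 0)"
    using assms(1) by (simp add: degree_def sum.If_cases Int_def)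
  also have "\<dots> = (\<Sum>e\<in>edges G. \<Sum>v\<in>A. if v \<in> e then 1 else 0)"
    by (rule sum.swap)
  also have "\<dots> = (\<Sum>e\<in>edges G. card (e \<inter> A))"
    using assms(2) by (simp add: sum.If_cases Int_def conj_commute)
  finally show ?thesis .
qed

lemma handshake:
  assumes "simple_graph G"
  shows "(\<Sum>v\<in>verts G. degree G v) = 2 * card (edges G)"
proof -
  have "e \<inter> verts G = e \<and> card e = 2" if "e \<in> edges G" for e
    using that assms by (auto simp: simple_graph_def all_edges_def)
  then show ?thesis
    using assms by (simp add: sum_degree simple_graph_finite_edges simple_graph_def)
qed

lemma degree_ge_neighbours:
  assumes "finite (edges G)" "finite N" "\<And>w. w \<in> N \<Longrightarrow> adj G v w"
  shows "card N \<le> degree G v"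
proof -
  have "inj_on (\<lambda>w. {v, w}) N"
    by (auto simp: inj_on_def doubleton_eq_iff)
  then have "card N = card ((\<lambda>w. {v, w}) ` N)"
    by (simp add: card_image)
  also have "\<dots> \<le> degree G v"
    unfolding degree_def using assms by (intro card_mono) auto
  finally show ?thesis .
qed

text \<open>An edge has at least as many ends of degree three or more as it has ends in \<open>Y\<close>. Summed over all edges,
  \<open>2 |Y|\<close> is at most the sum of the degrees that are at least three, and a degree \<open>d\<close> of this kind is at
  most \<open>3 (d - 2)\<close>; the sum of \<open>d - 2\<close> over all vertices is \<open>2 (e - n)\<close>.\<close>
lemma card_sources_le:
  assumes G: "simple_graph G" and Y: "Y \<subseteq> verts G"
    and deg2: "\<And>v. v \<in> verts G \<Longrightarrow> degree G v \<ge> 2"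
    and deg3: "\<And>y u. y \<in> Y \<Longrightarrow> adj G y u \<Longrightarrow> degree G u \<ge> 3"
  shows "card Y + 3 * card (verts G) \<le> 3 * card (edges G)"
proof -
  have finE: "finite (edges G)" and finV: "finite (verts G)"
    using G simple_graph_finite_edges by (auto simp: simple_graph_def)
  define N where "N = {v \<in> verts G. degree G v \<ge> 3}"
  have "card (e \<inter> Y) \<le> card (e \<inter> N)" if "e \<in> edges G" for e
  proof -
    have "card e = 2"
      using that G by (auto simp: simple_graph_def all_edges_def)
    then obtain a b where e: "e = {a, b}" "a \<noteq> b"
      by (auto simp: card_2_iff)
    have ab: "a \<in> verts G" "b \<in> verts G" "adj G a b" "adj G b a"
      using that e simple_graph_adjD[OF G] by (auto simp: insert_commute)
    have "a \<in> Y \<Longrightarrow> b \<in> N" "b \<in> Y \<Longrightarrow> a \<in> N"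
      using ab deg3 by (auto simp: N_def)
    then show ?thesis
      using e by (cases "a \<in> Y"; cases "b \<in> Y"; cases "a \<in> N"; cases "b \<in> N") auto
  qed
  then have "(\<Sum>e\<in>edges G. card (e \<inter> Y)) \<le> (\<Sum>e\<in>edges G. card (e \<inter> N))"
    by (rule sum_mono)
  then have "(\<Sum>y\<in>Y. degree G y) \<le> (\<Sum>v\<in>N. degree G v)"
    using finE finV finite_subset[OF Y] by (simp add: sum_degree N_def)
  moreover have "(\<Sum>y\<in>Y. 2) \<le> (\<Sum>y\<in>Y. degree G y)"
    using Y deg2 by (intro sum_mono) auto
  moreover have "(\<Sum>v\<in>N. degree G v) \<le> (\<Sum>v\<in>verts G. 3 * (degree G v - 2))"
  proof -
    have "(\<Sum>v\<in>N. degree G v) \<le> (\<Sum>v\<in>N. 3 * (degree G v - 2))"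
      by (intro sum_mono) (auto simp: N_def)
    also have "\<dots> \<le> (\<Sum>v\<in>verts G. 3 * (degree G v - 2))"
      using finV by (intro sum_mono2) (auto simp: N_def)
    finally show ?thesis .
  qed
  moreover have "(\<Sum>v\<in>verts G. 3 * (degree G v - 2)) + (\<Sum>v\<in>verts G. 6) = (\<Sum>v\<in>verts G. 3 * degree G v)"
    unfolding sum.distrib[symmetric] using deg2 by (intro sum.cong) fastforce+
  moreover have "(\<Sum>v\<in>verts G. 3 * degree G v) = 6 * card (edges G)"
    using handshake[OF G] by (simp add: sum_distrib_left[symmetric])
  ultimately show ?thesis
    by simp
qed

lemma copy_of_cycle:
  assumes "path G xs" "length xs = k" "adj G (last xs) (hd xs)" "k \<ge> 2"
  shows "contains_copy G (cycle_graph k)"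
proof -
  have "joined G k (hd xs) (last xs)"
    using assms by (auto simp: joined_def)
  then have "contains_copy (add_edge G {hd xs, last xs}) (cycle_graph k)"
    using assms(4) by (rule copy_of_joined)
  moreover have "add_edge G {hd xs, last xs} = G"
    using assms(3) by (simp add: add_edge_def insert_absorb insert_commute)
  ultimately show ?thesis
    by simp
qed

text \<open>With \<open>X\<close> the set of pendant vertices and \<open>G0\<close> the graph without them, \<open>\<beta>\<close> is the cyclomatic number
  of \<open>G0\<close>. The two estimates \<open>|V0| \<le> 1 + (k - 1) \<beta>\<close> and \<open>|X| \<le> 3 (\<beta> - 1)\<close> add up to
  less than \<open>(k + 2) \<beta>\<close>.\<close>
lemma saturated_edges_lower_bound:
  assumes G: "simple_graph G" and sat: "saturated (cycle_graph k) G"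
    and k: "k \<ge> 7" and n: "card (verts G) \<ge> 3"
  obtains \<beta> where "card (verts G) + \<beta> \<le> card (edges G) + 1" "card (verts G) < (k + 2) * \<beta>"
proof -
  have finE: "finite (edges G)" and finV: "finite (verts G)"
    using G simple_graph_finite_edges by (auto simp: simple_graph_def)
  have free: "\<not> contains_copy G (cycle_graph k)"
    and join: "\<And>u v. u \<in> verts G \<Longrightarrow> v \<in> verts G \<Longrightarrow> u \<noteq> v \<Longrightarrow> \<not> adj G u v \<Longrightarrow> joined G k u v"
    using sat k by (auto simp: saturated_cycle_iff)
  have join_nth: "\<exists>xs. path G xs \<and> length xs = k \<and> xs ! 0 = u \<and> xs ! (k - 1) = v"
    if "joined G k u v" for u v
    using that k unfolding joined_def by (metis hd_conv_nth last_conv_nth list.size(3) not_numeral_le_zero)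
  have path_adj: "adj G (xs ! i) (xs ! Suc i)" if "path G xs" "Suc i < length xs" for xs i
    using that by (simp add: path_def successively_conv_nth)
  have path_eq: "xs ! i = xs ! j \<longleftrightarrow> i = j" if "path G xs" "i < length xs" "j < length xs" for xs i j
    using that by (simp add: path_def nth_eq_iff_index_eq)
  have path_in: "xs ! i \<in> verts G" if "path G xs" "i < length xs" for xs i
    using that by (auto simp: path_def)
  have other: "\<exists>t \<in> verts G. t \<noteq> a \<and> t \<noteq> b" for a b
  proof (rule ccontr)
    assume "\<not> ?thesis"
    then have "verts G \<subseteq> {a, b}" by auto
    then have "card (verts G) \<le> card {a, b}"
      by (intro card_mono) auto
    then show False
      using n by (simp add: card_insert_if split: if_splits)
  qed
  have nbr_exists: "\<exists>w. adj G v w" if v: "v \<in> verts G" for v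
  proof -
    obtain t where t: "t \<in> verts G" "t \<noteq> v"
      using other by blast
    show ?thesis
    proof (cases "adj G v t")
      case False
      then obtain xs where "path G xs" "length xs = k" "xs ! 0 = v"
        using join[of v t] join_nth[of v t] t v by auto
      then show ?thesis
        using path_adj[of xs 0] k by auto
    qed auto
  qed
  define X where "X = {v \<in> verts G. \<exists>!w. adj G v w}"
  define nb where "nb l = (THE w. adj G l w)" for l
  have nb: "adj G l (nb l)" "adj G l x \<Longrightarrow> x = nb l" if "l \<in> X" for l x
    using that theI'[of "\<lambda>w. adj G l w"] unfolding X_def nb_def by blast+
  \<comment> \<open>Inner vertices of paths have two neighbours. So deleting the pendant vertices spoils no path between
    the others.\<close>
  have inner_notin: "xs ! i \<notin> X" if "path G xs" "0 < i" "Suc i < length xs" for xs i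
  proof
    assume l: "xs ! i \<in> X"
    have "adj G (xs ! i) (xs ! Suc i)" "adj G (xs ! i) (xs ! (i - 1))"
      using path_adj[of xs i] path_adj[of xs "i - 1"] that by (auto simp: insert_commute)
    then have "xs ! Suc i = xs ! (i - 1)"
      using nb(2)[OF l] by metis
    moreover have "i - 1 < length xs" "Suc i \<noteq> i - 1"
      using that by auto
    ultimately show False
      using path_eq[OF that(1,3), of "i - 1"] by simp
  qed
  have nb_V: "nb l \<in> verts G" "nb l \<noteq> l" if "l \<in> X" for l
    using simple_graph_adjD[OF G nb(1)[OF that]] by auto
  have nb_notin: "nb l \<notin> X" if l: "l \<in> X" for l
  proof
    assume w: "nb l \<in> X"
    then have ww: "nb (nb l) = l"
      using nb(2)[OF w, of l] nb(1)[OF l] by (simp add: insert_commute)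
    obtain t where t: "t \<in> verts G" "t \<noteq> l" "t \<noteq> nb l"
      using other by blast
    then have "joined G k l t"
      using nb(2)[OF l, of t] l by (intro join) (auto simp: X_def)
    then obtain xs where xs: "path G xs" "length xs = k" "xs ! 0 = l"
      using join_nth by blast
    have "xs ! 1 = nb l"
      using nb(2)[OF l] path_adj[of xs 0] xs k by auto
    then show False
      using inner_notin[of xs 1] xs k w by auto
  qed
  \<comment> \<open>Two pendant vertices with the same neighbour would be joined only by a path on three vertices.\<close>
  have nb_inj: "l = l'" if l: "l \<in> X" "l' \<in> X" "nb l = nb l'" for l l'
  proof (rule ccontr)
    assume "l \<noteq> l'"
    moreover have "\<not> adj G l l'"
      using nb(2)[of l l'] nb_notin[of l] l by auto
    ultimately have "joined G k l l'"
      using l by (intro join) (auto simp: X_def)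
    then obtain xs where xs: "path G xs" "length xs = k" "xs ! 0 = l" "xs ! (k - 1) = l'"
      using join_nth by blast
    have e: "Suc (k - 2) = k - 1"
      using k by simp
    have "xs ! 1 = nb l"
      using nb(2)[of l] path_adj[of xs 0] xs k l by auto
    moreover have "xs ! (k - 2) = nb l'"
      using nb(2)[of l' "xs ! (k - 2)"] path_adj[of xs "k - 2"] xs k l e by (auto simp: insert_commute)
    ultimately show False
      using path_eq[of xs 1 "k - 2"] xs l k by auto
  qed
  define V0 where "V0 = verts G - X"
  define G0 where "G0 = \<lparr>verts = V0, edges = {e \<in> edges G. e \<subseteq> V0}\<rparr>"
  have vG0 [simp]: "verts G0 = V0"
    by (simp add: G0_def)
  have adj0: "adj G0 a b \<longleftrightarrow> adj G a b \<and> a \<in> V0 \<and> b \<in> V0" for a b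
    by (simp add: G0_def)
  have simple0: "simple_graph G0"
    using G by (auto simp: simple_graph_def G0_def all_edges_def V0_def)
  have finE0: "finite (edges G0)"
    using simple0 by (rule simple_graph_finite_edges)
  have two_nbrs: "\<exists>w. w \<noteq> u \<and> adj G v w" if "v \<in> V0" for u v
  proof -
    have "\<exists>w. adj G v w" "\<not> (\<exists>!w. adj G v w)"
      using that nbr_exists by (auto simp: V0_def X_def)
    then show ?thesis
      by metis
  qed
  have semi0: "joined G0 k u v" if uv: "u \<in> V0" "v \<in> V0" "u \<noteq> v" "\<not> adj G0 u v" for u v
  proof -
    have "joined G k u v"
      using uv by (intro join) (auto simp: adj0 V0_def)
    then obtain xs where xs: "path G xs" "length xs = k" "hd xs = u" "last xs = v"
      by (auto simp: joined_def)
    have "xs ! i \<in> V0" if i: "i < k" for i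
    proof -
      consider "i = 0" | "i = k - 1" | "0 < i" "Suc i < k"
        using i by linarith
      then show ?thesis
      proof cases
        case 3
        then show ?thesis
          using inner_notin[of xs i] path_in[of xs i] xs by (auto simp: V0_def)
      qed (use xs uv k hd_conv_nth[of xs] last_conv_nth[of xs] in force)+
    qed
    then have "set xs \<subseteq> V0"
      using xs(2) by (auto simp: in_set_conv_nth)
    then have "path G0 xs"
      using xs(1) unfolding path_def by (auto simp: adj0 successively_conv_nth)
    then show ?thesis
      using xs by (auto simp: joined_def)
  qed
  \<comment> \<open>A path from a pendant vertex \<open>l\<close> must continue from \<open>nb l\<close>; if \<open>nb l\<close> has only one other neighbour
    \<open>u\<close>, then the path from \<open>l\<close> to \<open>u\<close> ends after three vertices.\<close>
  have min_deg0: "\<exists>w. w \<noteq> u \<and> adj G0 v w" if v: "v \<in> V0" for u v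
  proof (rule ccontr)
    assume "\<not> ?thesis"
    then have only_u: "w = u" if "adj G v w" "w \<notin> X" for w
      using that v simple_graph_adjD[OF G that(1)] by (auto simp: adj0 V0_def)
    obtain l where l: "l \<noteq> u" "adj G v l"
      using two_nbrs[OF v] by blast
    have lX: "l \<in> X"
      using only_u l by blast
    have nb_l: "nb l = v"
      using nb(2)[OF lX, of v] l by (simp add: insert_commute)
    have only: "w = u \<or> w = l" if "adj G v w" for w
    proof (cases "w \<in> X")
      case True
      then have "nb w = v"
        using nb(2)[OF True, of v] that by (simp add: insert_commute)
      then show ?thesis
        using nb_inj True lX nb_l by metis
    next
      case False
      then show ?thesis using only_u that by blast
    qed
    obtain w where "w \<noteq> l" "adj G v w"
      using two_nbrs[OF v] by blast
    then have vu: "adj G v u"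
      using only by blast
    then have u: "u \<in> verts G" "u \<noteq> v"
      using simple_graph_adjD[OF G vu] by auto
    then have "\<not> adj G l u"
      using nb(2)[OF lX] nb_l by metis
    then have "joined G k l u"
      using lX l u by (intro join) (auto simp: X_def)
    then obtain xs where xs: "path G xs" "length xs = k" "xs ! 0 = l" "xs ! (k - 1) = u"
      using join_nth by blast
    have "xs ! 1 = v"
      using nb(2)[OF lX] path_adj[of xs 0] xs k nb_l by auto
    then have "adj G v (xs ! 2)"
      using path_adj[of xs 1] xs k by (simp add: numeral_2_eq_2)
    then have "xs ! 2 = xs ! 0 \<or> xs ! 2 = xs ! (k - 1)"
      using only xs by auto
    then show False
      using path_eq[of xs 2 0] path_eq[of xs 2 "k - 1"] xs(1,2) k by auto
  qed
  have deg2: "degree G0 v \<ge> 2" if v: "v \<in> V0" for v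
  proof -
    obtain a b where "adj G0 v a" "adj G0 v b" "b \<noteq> a"
      using min_deg0[OF v] by metis
    then have "card {a, b} \<le> degree G0 v"
      using finE0 by (intro degree_ge_neighbours) auto
    moreover have "card {a, b} = 2"
      using \<open>b \<noteq> a\<close> by simp
    ultimately show ?thesis
      by simp
  qed
  have deg3: "degree G0 u \<ge> 3" if y: "y \<in> nb ` X" "adj G0 y u" for y u
  proof (rule ccontr)
    assume small: "\<not> ?thesis"
    obtain l where l: "l \<in> X" "y = nb l"
      using y by auto
    have yu: "adj G0 u y" "u \<noteq> y" "u \<in> V0" "y \<in> V0"
      using y(2) simple_graph_adjD[OF simple0 y(2)] by (auto simp: insert_commute)
    obtain x where x: "x \<noteq> y" "adj G0 u x"
      using min_deg0[OF yu(3)] by blast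
    have xV: "x \<in> V0" "x \<noteq> u"
      using simple_graph_adjD[OF simple0 x(2)] by auto
    have only: "t = y \<or> t = x" if "adj G0 u t" for t
    proof (rule ccontr)
      assume "\<not> ?thesis"
      then have "card {y, x, t} = 3"
        using x(1) by auto
      moreover have "card {y, x, t} \<le> degree G0 u"
        using finE0 that x yu(1) by (intro degree_ge_neighbours) auto
      ultimately show False
        using small by simp
    qed
    have "\<not> adj G l x"
      using nb(2)[OF l(1), of x] l x by auto
    then have "joined G k l x"
      using l xV by (intro join) (auto simp: X_def V0_def)
    then obtain xs where xs: "path G xs" "length xs = k" "xs ! 0 = l" "xs ! (k - 1) = x"
      using join_nth by blast
    have xs1: "xs ! 1 = y"
      using nb(2)[OF l(1)] path_adj[of xs 0] xs k l by auto
    \<comment> \<open>The only neighbours \<open>y\<close> and \<open>x\<close> of \<open>u\<close> are the second and the last vertex of the path, so there is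
      no place for \<open>u\<close> on it.\<close>
    have u_out: "u \<notin> set xs"
    proof
      assume "u \<in> set xs"
      then obtain i where i: "i < k" "xs ! i = u"
        using xs(2) by (auto simp: in_set_conv_nth)
      have "u \<noteq> l"
        using l yu(3) by (auto simp: V0_def)
      then have "i \<noteq> 0" "i \<noteq> 1" "i \<noteq> k - 1"
        using i(2) xs(3,4) xs1 yu(2) xV(2) by metis+
      then have i2: "2 \<le> i" "Suc i < k"
        using i by auto
      have "xs ! (i - 1) \<in> V0"
        using inner_notin[of xs "i - 1"] path_in[of xs "i - 1"] xs i2 by (auto simp: V0_def)
      moreover have "adj G u (xs ! (i - 1))"
        using path_adj[of xs "i - 1"] xs i2 i by (auto simp: insert_commute)
      ultimately have "xs ! (i - 1) = xs ! 1 \<or> xs ! (i - 1) = xs ! (k - 1)"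
        using only[of "xs ! (i - 1)"] yu xs xs1 by (auto simp: adj0)
      then have i_eq: "i = 2"
        using path_eq[of xs "i - 1" 1] path_eq[of xs "i - 1" "k - 1"] xs(1,2) i2 by auto
      have "xs ! 3 \<in> V0"
        using inner_notin[of xs 3] path_in[of xs 3] xs k by (auto simp: V0_def)
      moreover have "adj G u (xs ! 3)"
        using path_adj[of xs 2] xs k i i_eq by (auto simp: numeral_3_eq_3 numeral_2_eq_2)
      ultimately have "xs ! 3 = xs ! 1 \<or> xs ! 3 = xs ! (k - 1)"
        using only[of "xs ! 3"] yu xs xs1 by (auto simp: adj0)
      then show False
        using path_eq[of xs 3 1] path_eq[of xs 3 "k - 1"] xs(1,2) k by auto
    qed
    obtain zs where zs: "xs = l # zs"
      using xs k by (cases xs) auto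
    have "zs \<noteq> []" "length zs = k - 1"
      using zs xs k by auto
    moreover from this have "hd zs = y" "last zs = x"
      using zs xs xs1 k by (simp_all add: hd_conv_nth last_conv_nth nth_Cons')
    ultimately have "path G (zs @ [u])" "length (zs @ [u]) = k" "adj G (last (zs @ [u])) (hd (zs @ [u]))"
      using xs(1) u_out zs x(2) yu k
      by (auto simp: path_def successively_append_iff successively_Cons adj0 V0_def insert_commute)
    \<comment> \<open>Replacing \<open>l\<close> by \<open>u\<close> closes the path to a cycle of length \<open>k\<close>.\<close>
    then have "contains_copy G (cycle_graph k)"
      using k by (intro copy_of_cycle) auto
    then show False
      using free by simp
  qed
  have "nb ` X \<subseteq> V0"
    using nb_V nb_notin by (auto simp: V0_def)
  then have sources: "card X + 3 * card V0 \<le> 3 * card (edges G0)"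
    using card_sources_le[OF simple0, of "nb ` X"] deg2 deg3 nb_inj
    by (simp add: card_image inj_on_def)
  have cardV: "card (verts G) = card V0 + card X"
  proof -
    have "finite X" "X \<subseteq> verts G"
      using finV by (auto simp: X_def)
    then show ?thesis
      using finV card_mono[of "verts G" X] by (simp add: V0_def card_Diff_subset)
  qed
  have cardE: "card (edges G0) + card X \<le> card (edges G)"
  proof -
    have "inj_on (\<lambda>l. {l, nb l}) X"
      using nb_notin by (auto simp: inj_on_def doubleton_eq_iff)
    then have "card (edges G0) + card X = card (edges G0) + card ((\<lambda>l. {l, nb l}) ` X)"
      by (simp add: card_image)
    also have "\<dots> = card (edges G0 \<union> (\<lambda>l. {l, nb l}) ` X)"
      using finE0 finV by (intro card_Un_disjoint[symmetric]) (auto simp: G0_def V0_def X_def)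
    also have "\<dots> \<le> card (edges G)"
      using finE nb by (intro card_mono) (auto simp: G0_def)
    finally show ?thesis .
  qed
  have "V0 \<noteq> {}"
    using other[of undefined undefined] nb_V nb_notin by (auto simp: V0_def)
  then obtain j where j: "card V0 \<le> 1 + j * (k - 1)" "card V0 + j \<le> card (edges G0) + 1"
    using vertices_le_cyclomatic[OF simple0 k] min_deg0 semi0 by auto
  have "card V0 \<le> card (edges G0)"
    using sources by simp
  define \<beta> where "\<beta> = card (edges G0) + 1 - card V0"
  have \<beta>: "j \<le> \<beta>" "1 \<le> \<beta>" "card V0 + \<beta> = card (edges G0) + 1"
    using j \<open>card V0 \<le> card (edges G0)\<close> by (auto simp: \<beta>_def)
  have "card (verts G) \<le> 1 + \<beta> * (k - 1) + 3 * (\<beta> - 1)"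
    using cardV sources j(1) mult_le_mono1[OF \<beta>(1), of "k - 1"] \<beta> by linarith
  also have "\<dots> < (k + 2) * \<beta>"
  proof -
    obtain k' b where "k = Suc k'" "\<beta> = Suc b"
      using k \<beta>(2) by (cases k; cases \<beta>) auto
    then show ?thesis by (simp add: algebra_simps)
  qed
  finally have "card (verts G) < (k + 2) * \<beta>" .
  moreover have "card (verts G) + \<beta> \<le> card (edges G) + 1"
    using cardV cardE \<beta> by linarith
  ultimately show thesis
    by (rule that[rotated])
qed

section \<open>A sparse saturated graph\<close>

text \<open>Throughout, \<open>k = h + 7\<close>. The two poles are adjacent to each other and to both twins. The twins and the \<open>h + 2\<close>
  core vertices form a clique, except that the twins are not adjacent. Chain number \<open>u\<close> consists of the
  links \<open>Link u 1\<close>, \<dots>, \<open>Link u (h + 3)\<close> and leads from \<open>Pole True\<close> to \<open>Pole False\<close>. The first \<open>r\<close>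
  core vertices have a pendant neighbour.\<close>
datatype vertex = Pole bool | Twin bool | Core nat | Pendant nat | Link nat nat

instance vertex :: countable
  by countable_datatype

text \<open>Every edge is listed in one direction only.\<close>
fun arc :: "nat \<Rightarrow> nat \<Rightarrow> nat \<Rightarrow> vertex \<Rightarrow> vertex \<Rightarrow> bool" where
  "arc h m r (Pole a) (Pole b) \<longleftrightarrow> a \<and> \<not> b"
| "arc h m r (Pole a) (Twin b) \<longleftrightarrow> True"
| "arc h m r (Pole a) (Link u i) \<longleftrightarrow> a \<and> u < m \<and> i = 1"
| "arc h m r (Twin b) (Core i) \<longleftrightarrow> i < h + 2"
| "arc h m r (Core i) (Core j) \<longleftrightarrow> i < j \<and> j < h + 2"
| "arc h m r (Core i) (Pendant j) \<longleftrightarrow> i = j \<and> i < r"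
| "arc h m r (Link u i) (Link v j) \<longleftrightarrow> u = v \<and> u < m \<and> 1 \<le> i \<and> i < h + 3 \<and> j = Suc i"
| "arc h m r (Link u i) (Pole a) \<longleftrightarrow> \<not> a \<and> u < m \<and> i = h + 3"
| "arc _ _ _ _ _ \<longleftrightarrow> False"

definition hub_part :: "nat \<Rightarrow> vertex set" where
  "hub_part h = range Pole \<union> range Twin \<union> Core ` {..<h + 2}"

definition chain_graph :: "nat \<Rightarrow> nat \<Rightarrow> nat \<Rightarrow> vertex ugraph" where
  "chain_graph h m r = \<lparr>verts = hub_part h \<union> Pendant ` {..<r} \<union> (\<lambda>(u, i). Link u i) ` ({..<m} \<times> {1..h + 3}),
     edges = {{a, b} |a b. arc h m r a b}\<rparr>"

lemma adj_chain_graph [simp]: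
  "adj (chain_graph h m r) a b \<longleftrightarrow> arc h m r a b \<or> arc h m r b a"
  by (auto simp: chain_graph_def doubleton_eq_iff)

lemma verts_chain_graph [simp]:
  "Pole a \<in> verts (chain_graph h m r)"
  "Twin a \<in> verts (chain_graph h m r)"
  "Core i \<in> verts (chain_graph h m r) \<longleftrightarrow> i < h + 2"
  "Pendant i \<in> verts (chain_graph h m r) \<longleftrightarrow> i < r"
  "Link u i \<in> verts (chain_graph h m r) \<longleftrightarrow> u < m \<and> 1 \<le> i \<and> i \<le> h + 3"
  by (auto simp: chain_graph_def hub_part_def)

lemma UNIV_split_bool: "range f = {f True, f False}"
  by (auto simp: image_iff) (metis (full_types))

lemma finite_hub_part [simp]: "finite (hub_part h)"
  by (simp add: hub_part_def)

lemma card_hub_part: "card (hub_part h) = h + 6"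
proof -
  have "card (range Pole) = 2" "card (range Twin) = 2"
    by (simp_all add: UNIV_split_bool)
  moreover have "card (Core ` {..<h + 2}) = h + 2"
    by (simp add: card_image inj_on_def)
  moreover have "card (hub_part h) = card (range Pole) + card (range Twin) + card (Core ` {..<h + 2})"
    unfolding hub_part_def by (subst card_Un_disjoint; auto)+
  ultimately show ?thesis
    by simp
qed

lemma card_verts_chain_graph: "card (verts (chain_graph h m r)) = h + 6 + r + m * (h + 3)"
proof -
  have "card (verts (chain_graph h m r)) =
      card (hub_part h) + card (Pendant ` {..<r}) + card ((\<lambda>(u, i). Link u i) ` ({..<m} \<times> {1..h + 3}))"
    unfolding chain_graph_def ugraph.simps
    by (subst card_Un_disjoint; auto simp: hub_part_def)+
  moreover have "card (Pendant ` {..<r}) = r"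
    by (simp add: card_image inj_on_def)
  moreover have "card ((\<lambda>(u, i). Link u i) ` ({..<m} \<times> {1..h + 3})) = m * (h + 3)"
    by (subst card_image) (auto simp: inj_on_def card_cartesian_product)
  ultimately show ?thesis
    by (simp add: card_hub_part)
qed

lemma simple_chain_graph:
  assumes "r \<le> h + 2"
  shows "simple_graph (chain_graph h m r)"
proof -
  have "a \<in> verts (chain_graph h m r) \<and> b \<in> verts (chain_graph h m r) \<and> a \<noteq> b" if "arc h m r a b" for a b
    using that assms by (cases a; cases b) auto
  then have "edges (chain_graph h m r) \<subseteq> all_edges (verts (chain_graph h m r))"
    unfolding all_edges_def by (subst chain_graph_def) (auto simp: card_insert_if)
  moreover have "finite (verts (chain_graph h m r))"
    by (simp add: chain_graph_def)
  ultimately show ?thesis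
    by (simp add: simple_graph_def)
qed

text \<open>In \<open>E\<close>, edge number \<open>i\<close> of a chain follows vertex number \<open>i\<close>, where both poles are counted as vertices
  of the chain.\<close>
lemma card_edges_chain_graph:
  "card (edges (chain_graph h m r)) \<le> (h + 3 choose 2) + (h + 7) + m * (h + 4) + r"
proof -
  define S where "S = {{Pole True, Pole False}}"
  define A where "A = (\<lambda>(a, b). {Pole a, Twin b}) ` UNIV"
  define B where "B = (\<lambda>(b, i). {Twin b, Core i}) ` (UNIV \<times> {..<h + 2})"
  define C where "C = (`) Core ` {e. e \<subseteq> {..<h + 2} \<and> card e = 2}"
  define D where "D = (\<lambda>i. {Core i, Pendant i}) ` {..<r}"
  define E where "E = (\<lambda>(u, i). {if i = 0 then Pole True else Link u i, if i = h + 3 then Pole False else Link u (Suc i)}) ` ({..<m} \<times> {..h + 3})"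
  have "{a, b} \<in> S \<union> A \<union> B \<union> C \<union> D \<union> E" if "arc h m r a b" for a b
    using that
  proof (cases a; cases b)
    fix i j assume "a = Core i" "b = Core j"
    then have "{a, b} = Core ` {i, j}" "{i, j} \<subseteq> {..<h + 2}" "card {i, j} = 2"
      using that by auto
    then show ?thesis
      unfolding C_def by blast
  next
    fix u i v j assume "a = Link u i" "b = Link v j"
    then have "(u, i) \<in> {..<m} \<times> {..h + 3}" "{a, b} = {Link u i, Link u (Suc i)}" "i \<noteq> 0" "i \<noteq> h + 3"
      using that by auto
    then show ?thesis
      unfolding E_def by (force intro!: image_eqI[of _ _ "(u, i)"])
  next
    fix c u i assume "a = Pole c" "b = Link u i"
    then have "(u, 0) \<in> {..<m} \<times> {..h + 3}" "{a, b} = {Pole True, Link u (Suc 0)}"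
      using that by auto
    then show ?thesis
      unfolding E_def by (force intro!: image_eqI[of _ _ "(u, 0)"])
  next
    fix u i c assume "a = Link u i" "b = Pole c"
    then have "(u, i) \<in> {..<m} \<times> {..h + 3}" "{a, b} = {Link u i, Pole False}" "i = h + 3"
      using that by auto
    then show ?thesis
      unfolding E_def by (force intro!: image_eqI[of _ _ "(u, i)"])
  qed (auto simp: S_def A_def B_def D_def)
  then have sub: "edges (chain_graph h m r) \<subseteq> S \<union> A \<union> B \<union> C \<union> D \<union> E"
    by (auto simp: chain_graph_def)
  have fin: "finite S" "finite A" "finite B" "finite C" "finite D" "finite E"
    by (simp_all add: S_def A_def B_def C_def D_def E_def)
  have "card S = 1" by (simp add: S_def)
  moreover have "card A \<le> 4"
  proof -
    have "card (UNIV :: (bool \<times> bool) set) = 4"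
      by (simp add: UNIV_bool flip: UNIV_Times_UNIV)
    then show ?thesis
      unfolding A_def using card_image_le[of UNIV "\<lambda>(a, b). {Pole a, Twin b}"] by simp
  qed
  moreover have "card B \<le> 2 * (h + 2)"
    unfolding B_def by (rule order_trans[OF card_image_le]) (simp_all add: card_cartesian_product)
  moreover have "card C \<le> (h + 2 choose 2)"
    unfolding C_def by (rule order_trans[OF card_image_le]) (simp_all add: n_subsets)
  moreover have "card D \<le> r"
    unfolding D_def by (rule order_trans[OF card_image_le]) simp_all
  moreover have "card E \<le> m * (h + 4)"
    unfolding E_def by (rule order_trans[OF card_image_le]) (simp_all add: card_cartesian_product)
  moreover have "card (edges (chain_graph h m r)) \<le> card S + card A + card B + card C + card D + card E"
    using card_mono[OF _ sub] fin card_Un_le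
    by (smt (verit) add_mono_thms_linordered_semiring(3) finite_UnI le_trans)
  moreover have "(h + 3 choose 2) = (h + 2 choose 2) + (h + 2)"
    by (simp add: numeral_2_eq_2 numeral_3_eq_3)
  ultimately show ?thesis
    by simp
qed

lemma core_list_exists:
  assumes "finite A" "n + card A \<le> h + 2"
  obtains js where "distinct js" "set js \<subseteq> {..<h + 2} - A" "length js = n"
proof -
  have "n \<le> card ({..<h + 2} - A)"
    using diff_card_le_card_Diff[OF assms(1), of "{..<h + 2}"] assms(2) by simp
  then obtain B where "B \<subseteq> {..<h + 2} - A" "card B = n" "finite B"
    by (rule obtain_subset_with_card_n)
  then show thesis
    using that finite_distinct_list[of B] by (metis distinct_card)
qed

lemma successively_core:
  assumes "distinct js" "set js \<subseteq> {..<h + 2}"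
  shows "successively (adj (chain_graph h m r)) (map Core js)"
  using assms
proof (induction js)
  case (Cons a js)
  then show ?case
    by (cases js) auto
qed simp

section \<open>Nonadjacent vertices of the construction\<close>

text \<open>A path of length \<open>s\<close> from \<open>Pole True\<close> to \<open>c\<close> inside the dense part, which can be extended at
  its first vertex into a chain.\<close>
definition route :: "nat \<Rightarrow> nat \<Rightarrow> nat \<Rightarrow> nat \<Rightarrow> vertex \<Rightarrow> vertex list \<Rightarrow> bool" where
  "route h m r s c cp \<longleftrightarrow> path (chain_graph h m r) cp \<and> set cp \<subseteq> hub_part h \<and>
     hd cp = Pole True \<and> last cp = c \<and> length cp = Suc s"

lemma hub_part_simps [simp]:
  "Pole a \<in> hub_part h" "Twin a \<in> hub_part h" "Core i \<in> hub_part h \<longleftrightarrow> i < h + 2"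
  "Pendant i \<notin> hub_part h" "Link u i \<notin> hub_part h"
  by (auto simp: hub_part_def)

lemma hub_subset_verts: "hub_part h \<subseteq> verts (chain_graph h m r)"
  by (auto simp: chain_graph_def)

text \<open>Any list of distinct core vertices is a path. It serves as a filler of prescribed length \<open>n\<close>; the set \<open>A\<close>
  holds the core vertices that a surrounding path needs elsewhere, and the ends are recorded for gluing.\<close>
definition core_segment :: "nat \<Rightarrow> nat \<Rightarrow> nat \<Rightarrow> nat set \<Rightarrow> nat \<Rightarrow> vertex list \<Rightarrow> bool" where
  "core_segment h m r A n xs \<longleftrightarrow> distinct xs \<and> set xs \<subseteq> Core ` ({..<h + 2} - A) \<and> length xs = n \<and>
     successively (adj (chain_graph h m r)) xs \<and>
     (xs \<noteq> [] \<longrightarrow> (\<exists>i<h + 2. i \<notin> A \<and> hd xs = Core i) \<and> (\<exists>i<h + 2. i \<notin> A \<and> last xs = Core i))"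

lemma core_segment_exists:
  assumes "finite A" "n + card A \<le> h + 2"
  obtains xs where "core_segment h m r A n xs"
proof -
  obtain js where js: "distinct js" "set js \<subseteq> {..<h + 2} - A" "length js = n"
    using core_list_exists[OF assms] .
  have "successively (adj (chain_graph h m r)) (map Core js)"
    using js by (intro successively_core) auto
  moreover have "hd js \<in> {..<h + 2} - A" "last js \<in> {..<h + 2} - A" if "js \<noteq> []"
    using js(2) that by (auto dest: hd_in_set last_in_set)
  ultimately have "core_segment h m r A n (map Core js)"
    using js unfolding core_segment_def by (auto simp: distinct_map inj_on_def hd_map last_map)
  then show thesis
    by (rule that)
qed

lemma hd_links [simp]: "i < j \<Longrightarrow> hd (map (Link u) [i..<j]) = Link u i"
  by (simp add: hd_map)

lemma last_links [simp]: "i < j \<Longrightarrow> last (map (Link u) [i..<j]) = Link u (j - 1)"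
  by (simp add: last_map)

text \<open>Length \<open>3\<close> is the exception: the second and the second last vertex of such a path would be adjacent, and
  both would be adjacent to a pole. But both would be twins, and the twins are not adjacent.\<close>
lemma route_pole:
  assumes "s = 1 \<or> s = 2 \<or> 4 \<le> s \<and> s \<le> h + 5"
  obtains cp where "route h m r s (Pole False) cp"
proof -
  consider "s = 1" | "s = 2" | "4 \<le> s" "s \<le> h + 5"
    using assms by blast
  then show thesis
  proof cases
    case 1
    then have "route h m r s (Pole False) [Pole True, Pole False]"
      by (simp add: route_def path_def)
    then show thesis by (rule that)
  next
    case 2
    then have "route h m r s (Pole False) [Pole True, Twin True, Pole False]"
      by (simp add: route_def path_def)
    then show thesis by (rule that)
  next
    case 3
    obtain xs where xs: "core_segment h m r {} (s - 3) xs"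
    by (rule core_segment_exists[of "{}" "s - 3" h m r]) (use assms 3 in auto)
    then have "route h m r s (Pole False) ([Pole True, Twin True] @ xs @ [Twin False, Pole False])"
      using 3 by (auto simp: route_def path_def core_segment_def successively_append_iff successively_Cons hd_append)
    then show thesis by (rule that)
  qed
qed

lemma route_twin:
  assumes "3 \<le> s" "s \<le> h + 5"
  obtains cp where "route h m r s (Twin b) cp"
proof (cases "s = 3")
  case True
  then have "route h m r s (Twin b) [Pole True, Twin (\<not> b), Pole False, Twin b]"
    by (simp add: route_def path_def)
  then show thesis by (rule that)
next
  case False
  obtain xs where xs: "core_segment h m r {} (s - 3) xs"
    by (rule core_segment_exists[of "{}" "s - 3" h m r]) (use assms False in auto)
  then have "route h m r s (Twin b) ([Pole True, Pole False, Twin (\<not> b)] @ xs @ [Twin b])"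
    using False assms by (auto simp: route_def path_def core_segment_def successively_append_iff successively_Cons hd_append)
  then show thesis by (rule that)
qed

lemma route_core:
  assumes "2 \<le> s" "s \<le> h + 5" and q: "q < h + 2"
  obtains cp where "route h m r s (Core q) cp"
proof -
  consider "s = 2" | "s = 3" | "4 \<le> s"
    using assms by linarith
  then show thesis
  proof cases
    case 1
    then have "route h m r s (Core q) [Pole True, Twin True, Core q]"
      using q by (simp add: route_def path_def)
    then show thesis by (rule that)
  next
    case 2
    then have "route h m r s (Core q) [Pole True, Pole False, Twin True, Core q]"
      using q by (simp add: route_def path_def)
    then show thesis by (rule that)
  next
    case 3
    obtain xs where xs: "core_segment h m r {q} (s - 4) xs"
    by (rule core_segment_exists[of "{q}" "s - 4" h m r]) (use assms 3 in auto)
    then have "route h m r s (Core q) ([Pole True, Twin False, Pole False, Twin True] @ xs @ [Core q])"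
      using 3 q by (auto simp: route_def path_def core_segment_def successively_append_iff successively_Cons hd_append)
    then show thesis by (rule that)
  qed
qed

text \<open>Vertex number \<open>i\<close> of a chain when the poles are counted as its ends, which allows a uniform
  treatment of links and poles.\<close>
definition chain_vertex :: "nat \<Rightarrow> nat \<Rightarrow> nat \<Rightarrow> vertex" where
  "chain_vertex h u i = (if i = 0 then Pole True else if i = h + 4 then Pole False else Link u i)"

lemma successively_links:
  assumes "u < m" "1 \<le> i" "j \<le> h + 4"
  shows "successively (adj (chain_graph h m r)) (map (Link u) [i..<j])"
    "successively (adj (chain_graph h m r)) (rev (map (Link u) [i..<j]))"
proof -
  show *: "successively (adj (chain_graph h m r)) (map (Link u) [i..<j])"
    using assms by (auto simp: successively_conv_nth)
  have "successively (\<lambda>x y. adj (chain_graph h m r) y x) (map (Link u) [i..<j])"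
    using * by (rule successively_mono) auto
  then show "successively (adj (chain_graph h m r)) (rev (map (Link u) [i..<j]))"
    by (simp only: successively_rev)
qed

lemma hd_rev_links: "hd (rev (map (Link u) [1..<Suc i]) @ xs) = (if i = 0 then hd xs else Link u i)"
  by (cases i) auto

lemma last_rev_links:
  "last (xs @ rev (map (Link u) [j..<h + 4])) = (if h + 4 \<le> j then last xs else Link u j)"
  by (auto simp: last_rev upt_conv_Cons)

text \<open>Descend the chain \<open>u\<close> from position \<open>i\<close> to \<open>Pole True\<close>, cross the dense part by a route of length \<open>s\<close>,
  and follow the chain \<open>v\<close> from \<open>Pole False\<close> back to position \<open>j\<close>. The total length is
  \<open>i + s + (h + 4 - j)\<close>. On a single chain with \<open>i < j\<close> the two parts do not overlap.\<close>
lemma joined_through_hub: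
  assumes i: "i \<le> h + 3" and j: "1 \<le> j" "j \<le> h + 4" and apart: "u \<noteq> v \<or> i < j"
    and m: "u < m" "v < m" and s: "s + i = 2 + j" "s = 1 \<or> s = 2 \<or> 4 \<le> s \<and> s \<le> h + 5"
  shows "joined (chain_graph h m r) (h + 7) (chain_vertex h u i) (chain_vertex h v j)"
proof -
  obtain cp where cp: "route h m r s (Pole False) cp"
    using route_pole[OF s(2)] .
  define xs where "xs = rev (map (Link u) [1..<Suc i]) @ cp @ rev (map (Link v) [j..<h + 4])"
  have cp': "cp \<noteq> []" "distinct cp" "set cp \<subseteq> hub_part h" "successively (adj (chain_graph h m r)) cp"
    "hd cp = Pole True" "last cp = Pole False" "length cp = Suc s"
    using cp by (auto simp: route_def path_def)
  have "distinct xs"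
    using cp'(2,3) apart unfolding xs_def by (auto simp: distinct_map inj_on_def)
  moreover have "set xs \<subseteq> verts (chain_graph h m r)"
    using cp'(3) hub_subset_verts[of h m r] m i j by (auto simp: xs_def)
  moreover have "successively (adj (chain_graph h m r)) xs"
    unfolding xs_def successively_append_iff
    using cp' m i j
    by (intro conjI impI successively_links)
      (auto simp: last_rev hd_append hd_rev simp del: upt_Suc)
  ultimately have "path (chain_graph h m r) xs"
    by (simp add: path_def)
  moreover have "length xs = h + 7"
    using cp'(7) i j s(1) by (cases i) (auto simp: xs_def)
  moreover have "hd xs = chain_vertex h u i"
    using cp' i unfolding xs_def hd_rev_links by (auto simp: chain_vertex_def)
  moreover have "last xs = chain_vertex h v j"
    using cp' j unfolding xs_def append_assoc[symmetric] last_rev_links by (auto simp: chain_vertex_def)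
  ultimately show ?thesis
    by (auto simp: joined_def)
qed

lemma joined_link_hub:
  assumes "route h m r s c cp" "i \<le> h + 3" "u < m" "i + s = h + 6"
  shows "joined (chain_graph h m r) (h + 7) (chain_vertex h u i) c"
proof -
  define xs where "xs = rev (map (Link u) [1..<Suc i]) @ cp"
  have cp': "cp \<noteq> []" "distinct cp" "set cp \<subseteq> hub_part h" "successively (adj (chain_graph h m r)) cp"
    "hd cp = Pole True" "last cp = c" "length cp = Suc s"
    using assms(1) by (auto simp: route_def path_def)
  have "path (chain_graph h m r) xs"
    unfolding path_def xs_def successively_append_iff
    using cp' assms hub_subset_verts[of h m r] 
    by (intro conjI impI successively_links) (auto simp: last_rev distinct_map inj_on_def simp del: upt_Suc)
  moreover have "hd xs = chain_vertex h u i"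
    using cp' assms unfolding xs_def hd_rev_links by (auto simp: chain_vertex_def)
  ultimately show ?thesis
    using cp' assms(4) unfolding joined_def by (intro exI[of _ xs]) (auto simp: xs_def)
qed

lemma joined_link_pendant_route:
  assumes "route h m r s (Core q) cp" "i \<le> h + 3" "u < m" "i + s = h + 5" "q < r"
  shows "joined (chain_graph h m r) (h + 7) (chain_vertex h u i) (Pendant q)"
proof -
  define xs where "xs = rev (map (Link u) [1..<Suc i]) @ cp @ [Pendant q]"
  have cp': "cp \<noteq> []" "distinct cp" "set cp \<subseteq> hub_part h" "successively (adj (chain_graph h m r)) cp"
    "hd cp = Pole True" "last cp = Core q" "length cp = Suc s"
    using assms(1) by (auto simp: route_def path_def)
  have "path (chain_graph h m r) xs"
    unfolding path_def xs_def successively_append_iff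
    using cp' assms hub_subset_verts[of h m r] 
    by (intro conjI impI successively_links) (auto simp: last_rev distinct_map inj_on_def simp del: upt_Suc)
  moreover have "hd xs = chain_vertex h u i"
    using cp' assms unfolding xs_def hd_rev_links by (auto simp: chain_vertex_def)
  ultimately show ?thesis
    using cp' assms(4) unfolding joined_def by (intro exI[of _ xs]) (auto simp: xs_def)
qed


lemma joinedI:
  assumes "path G xs" "length xs = k" "hd xs = u" "last xs = v"
  shows "joined G k u v"
  using assms by (auto simp: joined_def)

text \<open>The dense part has only \<open>k - 1\<close> vertices, so a path on \<open>k\<close> vertices between two of its vertices has to
  traverse a chain; this is where at least one chain is used.\<close>
lemma joined_twins:
  assumes "0 < m"
  shows "joined (chain_graph h m r) (h + 7) (Twin True) (Twin False)"
  by (rule joinedI[of _ "[Twin True, Pole True] @ map (Link 0) [1..<h + 4] @ [Pole False, Twin False]"])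
    (use assms successively_links[of 0 m 1 "h + 4" h r] in
      \<open>auto simp: path_def successively_append_iff successively_Cons hd_append distinct_map inj_on_def simp del: upt_Suc\<close>)

lemma joined_pole_core:
  assumes "0 < m" "q < h + 2"
  shows "joined (chain_graph h m r) (h + 7) (Pole a) (Core q)"
proof (cases a)
  case True
  then show ?thesis
    by (intro joinedI[of _ "[Pole True] @ map (Link 0) [1..<h + 4] @ [Pole False, Twin True, Core q]"])
      (use assms successively_links[of 0 m 1 "h + 4" h r] in
        \<open>auto simp: path_def successively_append_iff successively_Cons hd_append distinct_map inj_on_def simp del: upt_Suc\<close>)
next
  case False
  then show ?thesis
    by (intro joinedI[of _ "[Pole False] @ rev (map (Link 0) [1..<h + 4]) @ [Pole True, Twin True, Core q]"])
      (use assms successively_links[of 0 m 1 "h + 4" h r] in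
        \<open>auto simp: path_def successively_append_iff successively_Cons hd_append hd_rev last_rev distinct_map inj_on_def simp del: upt_Suc\<close>)
qed

text \<open>A path from a pendant vertex to a vertex of the dense part has to cover that part completely; a path between
  two pendant vertices leaves out one vertex of it, here a pole.\<close>
lemma joined_pendant_pendant:
  assumes "p < r" "q < r" "p \<noteq> q" "r \<le> h + 2"
  shows "joined (chain_graph h m r) (h + 7) (Pendant p) (Pendant q)"
proof -
  obtain xs where "core_segment h m r {p, q} h xs"
    by (rule core_segment_exists[of "{p, q}" h h m r]) (use assms in auto)
  then show ?thesis
    by (intro joinedI[of _ "[Pendant p, Core p] @ xs @ [Twin True, Pole False, Twin False, Core q, Pendant q]"])
      (use assms in \<open>auto simp: path_def core_segment_def successively_append_iff successively_Cons hd_append\<close>)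
qed

lemma joined_pendant_core:
  assumes "p < r" "q < h + 2" "p \<noteq> q" "r \<le> h + 2"
  shows "joined (chain_graph h m r) (h + 7) (Pendant p) (Core q)"
proof -
  obtain xs where "core_segment h m r {p, q} h xs"
    by (rule core_segment_exists[of "{p, q}" h h m r]) (use assms in auto)
  then show ?thesis
    by (intro joinedI[of _ "[Pendant p, Core p] @ xs @ [Twin True, Pole True, Pole False, Twin False, Core q]"])
      (use assms in \<open>auto simp: path_def core_segment_def successively_append_iff successively_Cons hd_append\<close>)
qed

lemma joined_pendant_twin:
  assumes "p < r" "r \<le> h + 2"
  shows "joined (chain_graph h m r) (h + 7) (Pendant p) (Twin b)"
proof -
  obtain xs where "core_segment h m r {p} (h + 1) xs"
    by (rule core_segment_exists[of "{p}" "h + 1" h m r]) auto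
  then show ?thesis
    by (intro joinedI[of _ "[Pendant p, Core p] @ xs @ [Twin (\<not> b), Pole True, Pole False, Twin b]"])
      (use assms in \<open>auto simp: path_def core_segment_def successively_append_iff successively_Cons hd_append\<close>)
qed

lemma joined_pendant_pole:
  assumes "p < r" "r \<le> h + 2"
  shows "joined (chain_graph h m r) (h + 7) (Pendant p) (Pole a)"
proof -
  obtain xs where "core_segment h m r {p} (h + 1) xs"
    by (rule core_segment_exists[of "{p}" "h + 1" h m r]) auto
  then show ?thesis
    by (intro joinedI[of _ "[Pendant p, Core p] @ xs @ [Twin True, Pole (\<not> a), Twin False, Pole a]"])
      (use assms in \<open>auto simp: path_def core_segment_def successively_append_iff successively_Cons hd_append\<close>)
qed

text \<open>The route through the dense part has to have length \<open>2 + j - i\<close>, which is forbidden only if it is \<open>3\<close> or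
  less than \<open>1\<close>. For different chains one of the two directions always works; on one chain the forbidden
  length \<open>3\<close> belongs to adjacent links.\<close>
lemma joined_link_link:
  assumes "u < m" "v < m" "1 \<le> i" "i \<le> h + 3" "1 \<le> j" "j \<le> h + 3"
    and "u \<noteq> v \<or> i \<noteq> j" "\<not> adj (chain_graph h m r) (Link u i) (Link v j)"
  shows "joined (chain_graph h m r) (h + 7) (Link u i) (Link v j)"
proof -
  have chain_vertex: "chain_vertex h w l = Link w l" if "1 \<le> l" "l \<le> h + 3" for w l
    using that by (simp add: chain_vertex_def)
  have step: "joined (chain_graph h m r) (h + 7) (Link w l) (Link w' l')"
    if "w < m" "w' < m" "1 \<le> l" "l \<le> h + 3" "1 \<le> l'" "l' \<le> h + 3" "w \<noteq> w' \<or> l < l'"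
      "l \<le> Suc l'" "l' \<noteq> Suc l" for w w' l l'
    using joined_through_hub[of l h l' w w' m "2 + l' - l" r] that chain_vertex by fastforce
  show ?thesis
  proof (cases "u = v")
    case True
    then have "i < j \<and> j \<noteq> Suc i \<or> j < i \<and> i \<noteq> Suc j"
      using assms by auto
    then show ?thesis
    proof
      assume "i < j \<and> j \<noteq> Suc i"
      then show ?thesis
        using assms by (intro step) auto
    next
      assume "j < i \<and> i \<noteq> Suc j"
      then show ?thesis
        using assms by (intro joined_sym[OF step]) auto
    qed
  next
    case False
    have "i \<le> Suc j \<and> j \<noteq> Suc i \<or> j \<le> Suc i \<and> i \<noteq> Suc j"
      by linarith
    then show ?thesis
    proof
      assume "i \<le> Suc j \<and> j \<noteq> Suc i"
      then show ?thesis
        using assms False by (intro step) auto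
    next
      assume "j \<le> Suc i \<and> i \<noteq> Suc j"
      then show ?thesis
        using assms False by (intro joined_sym[OF step]) auto
    qed
  qed
qed

lemma joined_link_pole:
  assumes "u < m" "1 \<le> i" "i \<le> h + 3" "\<not> adj (chain_graph h m r) (Link u i) (Pole a)"
  shows "joined (chain_graph h m r) (h + 7) (Link u i) (Pole a)"
proof (cases a)
  case True
  then have "i \<noteq> 1"
    using assms by auto
  then show ?thesis
    using joined_sym[OF joined_through_hub[of 0 h i u u m "2 + i" r]] assms True by (auto simp: chain_vertex_def)
next
  case False
  then have "i \<noteq> h + 3"
    using assms by auto
  then have "4 \<le> h + 6 - i \<and> h + 6 - i \<le> h + 5"
    using assms by linarith
  then show ?thesis
    using joined_through_hub[of i h "h + 4" u u m "h + 6 - i" r] assms False by (auto simp: chain_vertex_def)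
qed

lemma joined_link_twin:
  assumes "u < m" "1 \<le> i" "i \<le> h + 3"
  shows "joined (chain_graph h m r) (h + 7) (Link u i) (Twin b)"
proof -
  obtain cp where "route h m r (h + 6 - i) (Twin b) cp"
    by (rule route_twin[of "h + 6 - i" h m r b]) (use assms in auto)
  then show ?thesis
    using joined_link_hub[of h m r "h + 6 - i" "Twin b" cp i u] assms by (auto simp: chain_vertex_def)
qed

lemma joined_link_core:
  assumes "u < m" "1 \<le> i" "i \<le> h + 3" "q < h + 2"
  shows "joined (chain_graph h m r) (h + 7) (Link u i) (Core q)"
proof -
  obtain cp where "route h m r (h + 6 - i) (Core q) cp"
    by (rule route_core[of "h + 6 - i" h q m r]) (use assms in auto)
  then show ?thesis
    using joined_link_hub[of h m r "h + 6 - i" "Core q" cp i u] assms by (auto simp: chain_vertex_def)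
qed

lemma joined_link_pendant:
  assumes "u < m" "1 \<le> i" "i \<le> h + 3" "q < r" "r \<le> h + 2"
  shows "joined (chain_graph h m r) (h + 7) (Link u i) (Pendant q)"
proof -
  obtain cp where "route h m r (h + 5 - i) (Core q) cp"
    by (rule route_core[of "h + 5 - i" h q m r]) (use assms in auto)
  then show ?thesis
    using joined_link_pendant_route[of h m r "h + 5 - i" q cp i u] assms by (auto simp: chain_vertex_def)
qed

text \<open>An arbitrary order of the vertex classes, by which each unordered pair of classes is treated
  only once.\<close>
fun kind :: "vertex \<Rightarrow> nat" where
  "kind (Pole _) = 0"
| "kind (Twin _) = 1"
| "kind (Core _) = 2"
| "kind (Pendant _) = 3"
| "kind (Link _ _) = 4"

lemma joined_chain_graph:
  assumes m: "0 < m" and r: "r \<le> h + 2"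
    and a: "a \<in> verts (chain_graph h m r)" and b: "b \<in> verts (chain_graph h m r)"
    and ab: "a \<noteq> b" "\<not> adj (chain_graph h m r) a b"
  shows "joined (chain_graph h m r) (h + 7) a b"
proof -
  have main: "joined (chain_graph h m r) (h + 7) a b"
    if "a \<in> verts (chain_graph h m r)" "b \<in> verts (chain_graph h m r)"
      "a \<noteq> b" "\<not> adj (chain_graph h m r) a b" "kind b \<le> kind a" for a b
  proof (cases a; cases b)
    fix c d assume *: "a = Pole c" "b = Pole d"
    then show ?thesis
      using that by (cases c; cases d) auto
  next
    fix c d assume *: "a = Twin c" "b = Twin d"
    then show ?thesis
      using that m joined_twins joined_sym[OF joined_twins] by (cases c; cases d) auto
  next
    fix i c assume *: "a = Core i" "b = Pole c"
    then show ?thesis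
      using that m joined_sym[OF joined_pole_core[where q = i and a = c]] by simp
  next
    fix i j assume *: "a = Core i" "b = Core j"
    then show ?thesis
      using that by auto
  next
    fix i b' assume *: "a = Core i" "b = Twin b'"
    then show ?thesis
      using that by simp
  next
    fix i c assume *: "a = Pendant i" "b = Pole c"
    then show ?thesis
      using that r joined_pendant_pole by simp
  next
    fix i c assume *: "a = Pendant i" "b = Twin c"
    then show ?thesis
      using that r joined_pendant_twin by simp
  next
    fix i j assume *: "a = Pendant i" "b = Core j"
    then show ?thesis
      using that r joined_pendant_core[where p = i and q = j] by auto
  next
    fix i j assume *: "a = Pendant i" "b = Pendant j"
    then show ?thesis
      using that r joined_pendant_pendant by simp
  next
    fix u i c assume *: "a = Link u i" "b = Pole c"
    then show ?thesis
      using that joined_link_pole[where u = u and i = i and a = c] by simp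
  next
    fix u i c assume *: "a = Link u i" "b = Twin c"
    then show ?thesis
      using that joined_link_twin by simp
  next
    fix u i j assume *: "a = Link u i" "b = Core j"
    then show ?thesis
      using that joined_link_core by simp
  next
    fix u i j assume *: "a = Link u i" "b = Pendant j"
    then show ?thesis
      using that r joined_link_pendant by simp
  next
    fix u i v j assume *: "a = Link u i" "b = Link v j"
    then show ?thesis
      using that unfolding * by (intro joined_link_link) simp_all
  qed (use that in simp_all)
  show ?thesis
  proof (cases "kind b \<le> kind a")
    case True
    then show ?thesis
      using a b ab by (intro main) auto
  next
    case False
    then show ?thesis
      using a b ab by (intro joined_sym[OF main]) auto
  qed
qed

section \<open>The construction has no cycle of length k\<close>

text \<open>A cycle as a periodic function on the integers, so that both rotation and reversal are substitutions.\<close>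
definition cyclic_walk :: "'a ugraph \<Rightarrow> nat \<Rightarrow> (int \<Rightarrow> 'a) \<Rightarrow> bool" where
  "cyclic_walk G k g \<longleftrightarrow> (\<forall>t. adj G (g t) (g (t + 1))) \<and> (\<forall>s t. g s = g t \<longleftrightarrow> int k dvd s - t)"

lemma cyclic_walk_of_copy:
  assumes "contains_copy G (cycle_graph k)" "k \<ge> 1"
  obtains g where "cyclic_walk G k g" "g ` {0..<int k} \<subseteq> verts G"
proof -
  obtain f where f: "inj_on f {..<k}" "f ` {..<k} \<subseteq> verts G"
    and fe: "\<And>i. i < k \<Longrightarrow> adj G (f i) (f (Suc i mod k))"
    using assms(1) by (auto simp: contains_copy_def cycle_graph_def)
  define g where "g t = f (nat (t mod int k))" for t
  have lt: "nat (t mod int k) < k" for t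
    using assms(2) by (simp add: nat_less_iff)
  have "adj G (g t) (g (t + 1))" for t
  proof -
    have "nat ((t + 1) mod int k) = Suc (nat (t mod int k)) mod k"
    proof -
      have "int (Suc (nat (t mod int k)) mod k) = (t mod int k + 1) mod int k"
        using assms(2) by (simp add: zmod_int add.commute)
      also have "\<dots> = (t + 1) mod int k"
        by (simp add: mod_add_left_eq)
      finally show ?thesis
        by (metis nat_int)
    qed
    then show ?thesis
      using fe[OF lt[of t]] by (simp add: g_def)
  qed
  moreover have "g s = g t \<longleftrightarrow> int k dvd s - t" for s t
  proof -
    have "g s = g t \<longleftrightarrow> nat (s mod int k) = nat (t mod int k)"
      using f(1) lt unfolding g_def by (auto dest: inj_onD)
    also have "\<dots> \<longleftrightarrow> s mod int k = t mod int k"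
      using assms(2) by (simp add: nat_eq_iff)
    also have "\<dots> \<longleftrightarrow> int k dvd s - t"
      by (rule mod_eq_dvd_iff)
    finally show ?thesis .
  qed
  ultimately have "cyclic_walk G k g"
    by (simp add: cyclic_walk_def)
  moreover have "g ` {0..<int k} \<subseteq> verts G"
    using f(2) lt unfolding g_def by blast
  ultimately show thesis
    by (rule that)
qed

lemma cyclic_walk_shift:
  assumes "cyclic_walk G k g"
  shows "cyclic_walk G k (\<lambda>t. g (s + t))" "cyclic_walk G k (\<lambda>t. g (s - t))"
proof -
  show "cyclic_walk G k (\<lambda>t. g (s + t))"
  proof -
    have "adj G (g (s + t)) (g (s + t + 1))" for t
      using assms unfolding cyclic_walk_def by blast
    then show ?thesis
      using assms by (simp add: cyclic_walk_def add.assoc)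
  qed
  have "adj G (g (s - t)) (g (s - (t + 1)))" for t
  proof -
    have "adj G (g (s - (t + 1))) (g (s - (t + 1) + 1))"
      using assms unfolding cyclic_walk_def by blast
    moreover have "s - (t + 1) + 1 = s - t"
      by simp
    ultimately show ?thesis
      by (simp only: insert_commute)
  qed
  moreover have "g (s - a) = g (s - b) \<longleftrightarrow> int k dvd a - b" for a b
  proof -
    have "s - a - (s - b) = - (a - b)"
      by simp
    then show ?thesis
      using assms unfolding cyclic_walk_def by (metis dvd_minus_iff)
  qed
  ultimately show "cyclic_walk G k (\<lambda>t. g (s - t))"
    unfolding cyclic_walk_def by blast
qed

lemma cyclic_walk_neq:
  assumes "cyclic_walk G k g" "s \<noteq> t" "\<bar>s - t\<bar> < int k"
  shows "g s \<noteq> g t"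
  using assms zdvd_imp_le[of "int k" "\<bar>s - t\<bar>"] by (auto simp: cyclic_walk_def)

lemma cyclic_walk_adj:
  assumes "cyclic_walk G k g"
  shows "adj G (g t) (g (t + 1))" "adj G (g t) (g (t - 1))"
proof -
  show "adj G (g t) (g (t + 1))"
    using assms by (simp add: cyclic_walk_def)
  have "adj G (g (t - 1)) (g (t - 1 + 1))"
    using assms unfolding cyclic_walk_def by blast
  then show "adj G (g t) (g (t - 1))"
    by (simp add: insert_commute)
qed

text \<open>A cycle through a vertex of degree at most two uses both of its neighbours.\<close>
lemma cyclic_walk_degree_two:
  assumes "cyclic_walk G k g" "k \<ge> 3" "g t = v" "\<And>x. adj G v x \<Longrightarrow> x = a \<or> x = b"
  shows "g (t + 1) = a \<and> g (t - 1) = b \<or> g (t + 1) = b \<and> g (t - 1) = a" "a \<noteq> b"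
proof -
  have "g (t + 1) \<noteq> g (t - 1)"
    using assms(2) by (intro cyclic_walk_neq[OF assms(1)]) auto
  moreover have "g (t + 1) = a \<or> g (t + 1) = b" "g (t - 1) = a \<or> g (t - 1) = b"
    using assms(4) cyclic_walk_adj[OF assms(1), of t] unfolding assms(3) by blast+
  ultimately show "g (t + 1) = a \<and> g (t - 1) = b \<or> g (t + 1) = b \<and> g (t - 1) = a" "a \<noteq> b"
    by auto
qed

text \<open>A cycle that enters a chain has to follow it to the other pole. Two vertices are left for the
  way back, hence it would contain a path of length \<open>3\<close> between the poles outside this chain.\<close>
lemma chain_graph_free_from_link:
  assumes g: "cyclic_walk (chain_graph h m r) (h + 7) g"
    and g0: "g 0 = Link u 1" and g1: "g 1 = Link u 2"
  shows False
proof -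
  let ?G = "chain_graph h m r"
  have neq: "g s \<noteq> g t" if "s \<noteq> t" "\<bar>s - t\<bar> < int h + 7" for s t
    using cyclic_walk_neq[OF g] that by simp
  note adj = cyclic_walk_adj[OF g]
  have u: "u < m"
    using adj(1)[of 0] g0 g1 by auto
  have run: "n \<le> h + 1 \<Longrightarrow> g (int n) = Link u (n + 1) \<and> g (int n + 1) = Link u (n + 2)" for n
  proof (induction n)
    case 0
    then show ?case using g0 g1 by (simp add: numeral_2_eq_2)
  next
    case (Suc n)
    then have IH: "g (int n) = Link u (n + 1)" "g (int n + 1) = Link u (n + 2)"
      by auto
    have "adj ?G (Link u (n + 2)) (g (int n + 2))"
      using adj(1)[of "int n + 1"] IH by (simp add: add.assoc)
    then have "g (int n + 2) = Link u (n + 1) \<or> g (int n + 2) = Link u (n + 3)"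
      using Suc.prems by (cases "g (int n + 2)") auto
    moreover have "g (int n + 2) \<noteq> g (int n)"
      by (rule neq) auto
    ultimately show ?case
      using IH by (auto simp: add.commute)
  qed
  have e: "int (h + 1) = int h + 1"
    by simp
  have gh: "g (int h + 1) = Link u (h + 2)" "g (int h + 2) = Link u (h + 3)"
    using run[of "h + 1"] unfolding e by (auto simp: add.assoc)
  have "adj ?G (Link u (h + 3)) (g (int h + 3))"
    using adj(1)[of "int h + 2"] gh by (simp add: add.assoc)
  then have "g (int h + 3) = Pole False \<or> g (int h + 3) = Link u (h + 2)"
    by (cases "g (int h + 3)") auto
  moreover have "g (int h + 3) \<noteq> g (int h + 1)"
    by (rule neq) auto
  ultimately have F: "g (int h + 3) = Pole False"
    using gh by auto
  have "g (- 1) = Pole True \<or> g (- 1) = Link u 2"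
    using adj(2)[of 0] g0 by (cases "g (- 1)") auto
  moreover have "g (- 1) \<noteq> g 1"
    by (rule neq) auto
  moreover have "g (- 1) = g (int h + 6)"
  proof -
    have "- 1 - (int h + 6) = - int (h + 7)"
      by simp
    then have "int (h + 7) dvd - 1 - (int h + 6)"
      by (metis dvd_minus_iff dvd_refl)
    then show ?thesis
      using g unfolding cyclic_walk_def by blast
  qed
  ultimately have T: "g (int h + 6) = Pole True"
    using g1 by auto
  have "adj ?G (Pole False) (g (int h + 4))" "adj ?G (g (int h + 4)) (g (int h + 5))"
    "adj ?G (g (int h + 5)) (Pole True)"
    using adj(1)[of "int h + 3"] adj(1)[of "int h + 4"] adj(1)[of "int h + 5"] F T by (auto simp: add.assoc)
  moreover have "g (int h + 4) \<noteq> Pole True" "g (int h + 5) \<noteq> Pole False"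
    using neq[of "int h + 4" "int h + 6"] neq[of "int h + 5" "int h + 3"] F T by auto
  ultimately show False
    by (cases "g (int h + 4)"; cases "g (int h + 5)") auto
qed

text \<open>A cycle through any link passes the first link of its chain and, after rotation and reversal,
  continues to the second. A cycle without links avoids the pendant vertices and is too long for the dense
  part.\<close>
lemma chain_graph_free: "\<not> contains_copy (chain_graph h m r) (cycle_graph (h + 7))"
proof
  let ?G = "chain_graph h m r"
  assume "contains_copy ?G (cycle_graph (h + 7))"
  then obtain g where g: "cyclic_walk ?G (h + 7) g" and gV: "g ` {0..<int (h + 7)} \<subseteq> verts ?G"
    by (rule cyclic_walk_of_copy) simp
  have no_link: "g t \<noteq> Link u 1" for u t
  proof
    assume gt: "g t = Link u 1"
    have "x = Pole True \<or> x = Link u 2" if "adj ?G (Link u 1) x" for x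
      using that by (cases x) auto
    from cyclic_walk_degree_two(1)[OF g _ gt this]
    consider "g (t + 1) = Link u 2" | "g (t - 1) = Link u 2"
      by auto
    then show False
      using chain_graph_free_from_link[OF cyclic_walk_shift(1)[OF g, of t], of u]
        chain_graph_free_from_link[OF cyclic_walk_shift(2)[OF g, of t], of u] gt
      by cases auto
  qed
  have no_links: "g t \<noteq> Link u (Suc i)" for u i t
  proof (induction i arbitrary: t)
    case 0
    then show ?case using no_link[of t u] by simp
  next
    case (Suc i)
    show ?case
    proof
      assume gt: "g t = Link u (Suc (Suc i))"
      define b where "b = (if Suc (Suc i) = h + 3 then Pole False else Link u (Suc (Suc (Suc i))))"
      have "x = Link u (Suc i) \<or> x = b" if "adj ?G (Link u (Suc (Suc i))) x" for x
        using that by (cases x) (auto simp: b_def)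
      from cyclic_walk_degree_two(1)[OF g _ gt this] show False
        using Suc.IH by auto
    qed
  qed
  have "g t \<in> hub_part h" if "t \<in> {0..<int (h + 7)}" for t
  proof -
    have gt: "g t \<in> verts ?G"
      using gV that by auto
    have "g t \<noteq> Pendant q" for q
    proof
      assume *: "g t = Pendant q"
      have "x = Core q \<or> x = Core q" if "adj ?G (Pendant q) x" for x
        using that by (cases x) auto
      from cyclic_walk_degree_two(2)[OF g _ * this] show False
        by auto
    qed
    moreover have "g t \<noteq> Link u i" for u i
      using no_links[of t u "i - 1"] gt by (cases i) auto
    ultimately show ?thesis
      using gt by (cases "g t") (auto simp: hub_part_def)
  qed
  then have "g ` {0..<int (h + 7)} \<subseteq> hub_part h"
    by auto
  then have "card (g ` {0..<int (h + 7)}) \<le> h + 6"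
    using card_mono[of "hub_part h"] by (simp add: card_hub_part)
  moreover have "inj_on g {0..<int (h + 7)}"
    using cyclic_walk_neq[OF g] by (force simp: inj_on_def)
  ultimately show False
    by (simp add: card_image)
qed

section \<open>The two bounds\<close>

lemma sat_cycle_lower_bound:
  assumes k: "k \<ge> 7" and n: "n \<ge> 3"
  shows "(1 + 1 / (real k + 2)) * real n - 1 < real (sat n (cycle_graph k))"
proof -
  have "edges (cycle_graph k) \<noteq> {}"
    using card_edges_cycle_graph[of k] k by auto
  from sat_attained[OF this, of n] obtain G :: "nat ugraph" where G: "simple_graph G" "card (verts G) = n"
      "saturated (cycle_graph k) G" "card (edges G) = sat n (cycle_graph k)"
    by blast
  obtain \<beta> where \<beta>: "n + \<beta> \<le> sat n (cycle_graph k) + 1" "n < (k + 2) * \<beta>"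
    using saturated_edges_lower_bound[OF G(1,3) k] G(2,4) n by auto
  have "real n < (real k + 2) * real \<beta>"
    using \<beta>(2) by (metis of_nat_add of_nat_less_iff of_nat_mult of_nat_numeral)
  then have "real n / (real k + 2) < real \<beta>"
    by (simp add: divide_less_eq mult.commute)
  moreover have "real n + real \<beta> \<le> real (sat n (cycle_graph k)) + 1"
    using \<beta>(1) by linarith
  ultimately show ?thesis
    by (simp add: algebra_simps)
qed

text \<open>The graph has \<open>m\<close> chains and \<open>r\<close> pendant vertices, where \<open>n - (k - 1) = m (k - 4) + r\<close>. The bound on
  \<open>n\<close> says that \<open>m\<close> is positive.\<close>
lemma sat_cycle_upper_bound:
  assumes n: "n \<ge> 2 * h + 9"
  shows "real (sat n (cycle_graph (h + 7))) < (1 + 1 / (real h + 3)) * real n + real ((h + 3) choose 2)"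
proof -
  define m where "m = (n - (h + 6)) div (h + 3)"
  define r where "r = (n - (h + 6)) mod (h + 3)"
  have "m * (h + 3) + r = n - (h + 6)"
    unfolding m_def r_def by (rule div_mult_mod_eq)
  then have n_eq: "n = h + 6 + r + m * (h + 3)"
    using n by simp
  have "1 * (h + 3) \<le> n - (h + 6)"
    using n by simp
  then have m: "0 < m"
    unfolding m_def by (simp add: div_greater_zero_iff)
  have r: "r \<le> h + 2"
  proof -
    have "r < h + 3"
      unfolding r_def by (rule mod_less_divisor) simp
    then show ?thesis
      by simp
  qed
  have "saturated (cycle_graph (h + 7)) (chain_graph h m r)"
    using joined_chain_graph[OF m r] chain_graph_free by (simp add: saturated_cycle_iff)
  then have "sat n (cycle_graph (h + 7)) \<le> card (edges (chain_graph h m r))"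
    using sat_le_relabel[OF simple_chain_graph[OF r]] by (simp add: card_verts_chain_graph n_eq)
  also have "\<dots> \<le> ((h + 3) choose 2) + n + (m + 1)"
    using card_edges_chain_graph[of h m r] unfolding n_eq by (simp add: algebra_simps)
  finally have "real (sat n (cycle_graph (h + 7))) \<le> real ((h + 3) choose 2) + real n + (real m + 1)"
    by linarith
  moreover have "real m + 1 < real n / (real h + 3)"
    unfolding n_eq by (simp add: field_simps)
  ultimately show ?thesis
    by (simp add: algebra_simps)
qed

theorem theorem2p1:
  fixes k n :: nat
  assumes "k \<ge> 7" and "n \<ge> 2 * k - 5"
  shows "(1 + 1 / (real k + 2)) * real n - 1 < real (sat n (cycle_graph k)) \<and>
         real (sat n (cycle_graph k)) < (1 + 1 / (real k - 4)) * real n + real ((k - 4) choose 2)"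
proof
  show "(1 + 1 / (real k + 2)) * real n - 1 < real (sat n (cycle_graph k))"
    using assms by (intro sat_cycle_lower_bound) auto
  obtain h where h: "k = h + 7"
    using assms(1) by (metis le_add_diff_inverse2)
  then show "real (sat n (cycle_graph k)) < (1 + 1 / (real k - 4)) * real n + real ((k - 4) choose 2)"
    using sat_cycle_upper_bound[of h n] assms(2) by (simp add: add.commute)
qed

end
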